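(* For all $f,g\in L^2(\mathbb{R}^N)$, $$\langle f,g\rangle=\langle \mathcal{Q}_{\boldsymbol{\Lambda}}f,\ \mathcal{Q}_{\boldsymbol{\Lambda}}g\rangle .$$
   Context: Let $N\ge 1$ and $\boldsymbol{\Lambda}=(\Lambda_1,\dots,\Lambda_N)$ with $\Lambda_k=(a_k,b_k,c_k,d_k,e_k)\in\mathbb{R}^5$ and $b_k\neq 0$ for $k=1,\dots,N$. The kernel is $$\mathcal{K}_{\boldsymbol{\Lambda}}(\boldsymbol{\omega},\boldsymbol{x})=\prod_{k=1}^N\sqrt{\tfrac{b_k}{2\pi i}}\;e^{i(a_kx_k^2+b_kx_k\omega_k+c_k\omega_k^2+d_kx_k+e_k\omega_k)},\qquad \boldsymbol{\omega},\boldsymbol{x}\in\mathbb{R}^N,$$ with principal square roots. The multidimensional quadratic phase Fourier transform (QPFT) of $f\in L^1(\mathbb{R}^N)$ is $(\mathcal{Q}_{\boldsymbol{\Lambda}}f)(\boldsymbol{\omega})=\int_{\mathbb{R}^N}\mathcal{K}_{\boldsymbol{\Lambda}}(\boldsymbol{\omega},\boldsymbol{x})f(\boldsymbol{x})\,d\boldsymbol{x}$. On $L^2(\mathbb{R}^N)$, $\mathcal{Q}_{\boldsymbol{\Lambda}}$ denotes the continuous extension to $L^2(\mathbb{R}^N)$ of its restriction to $L^1(\mathbb{R}^N)\cap L^2(\mathbb{R}^N)$. The inner product is $\langle f,g\rangle=\int_{\mathbb{R}^N}f(\boldsymbol{x})\overline{g(\boldsymbol{x})}\,d\boldsymbol{x}$.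 *)

theory Defs
  imports "HOL-Analysis.Analysis"
begin

text \<open>
  One parameter tuple \<open>\<Lambda>\<^sub>k = (a\<^sub>k, b\<^sub>k, c\<^sub>k, d\<^sub>k, e\<^sub>k)\<close>. A family \<open>\<Lambda>\<close> of such tuples is indexed by the
  finite type \<open>'n\<close> that also indexes the coordinates, so \<open>N = CARD('n)\<close>, and \<open>N \<ge> 1\<close>
  since types are nonempty.
\<close>

record qpft_param =
  coeff_a :: real
  coeff_b :: real
  coeff_c :: real
  coeff_d :: real
  coeff_e :: real

definition qpft_kernel ::
    "('n::finite \<Rightarrow> qpft_param) \<Rightarrow> real ^ 'n \<Rightarrow> real ^ 'n \<Rightarrow> complex" where
  "qpft_kernel \<Lambda> \<omega> x =
     (\<Prod>k\<in>UNIV. csqrt (complex_of_real (coeff_b (\<Lambda> k)) / (2 * complex_of_real pi * \<i>)) *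
        exp (\<i> * complex_of_real
          (coeff_a (\<Lambda> k) * (x $ k)\<^sup>2 + coeff_b (\<Lambda> k) * x $ k * \<omega> $ k
           + coeff_c (\<Lambda> k) * (\<omega> $ k)\<^sup>2 + coeff_d (\<Lambda> k) * x $ k + coeff_e (\<Lambda> k) * \<omega> $ k)))"

definition qpft_L1 ::
    "('n::finite \<Rightarrow> qpft_param) \<Rightarrow> (real ^ 'n \<Rightarrow> complex) \<Rightarrow> real ^ 'n \<Rightarrow> complex" where
  "qpft_L1 \<Lambda> f \<omega> = (LINT x|lebesgue. qpft_kernel \<Lambda> \<omega> x * f x)"

text \<open>
  \<open>L\<^sup>1\<close> and \<open>L\<^sup>2\<close> are rendered as sets of functions rather than of equivalence classes; equality
  in these spaces is equality almost everywhere.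
\<close>

definition L1_space :: "(real ^ 'n::finite \<Rightarrow> complex) set" where
  "L1_space = {f. integrable lebesgue f}"

definition L2_space :: "(real ^ 'n::finite \<Rightarrow> complex) set" where
  "L2_space = {f. f \<in> borel_measurable lebesgue \<and> integrable lebesgue (\<lambda>x. (norm (f x))\<^sup>2)}"

definition L2_inner :: "(real ^ 'n::finite \<Rightarrow> complex) \<Rightarrow> (real ^ 'n \<Rightarrow> complex) \<Rightarrow> complex" where
  "L2_inner f g = (LINT x|lebesgue. f x * cnj (g x))"

definition L2_norm :: "(real ^ 'n::finite \<Rightarrow> complex) \<Rightarrow> real" where
  "L2_norm f = sqrt (LINT x|lebesgue. (norm (f x))\<^sup>2)"

text \<open>
  Continuity is with respect to the seminorm \<open>L2_norm\<close>; in particular, such a \<open>T\<close> maps functions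
  that agree almost everywhere to functions that agree almost everywhere.
\<close>

definition is_continuous_qpft_extension ::
    "('n::finite \<Rightarrow> qpft_param) \<Rightarrow>
     ((real ^ 'n \<Rightarrow> complex) \<Rightarrow> (real ^ 'n \<Rightarrow> complex)) \<Rightarrow> bool" where
  "is_continuous_qpft_extension \<Lambda> T \<longleftrightarrow>
     (\<forall>f\<in>L2_space. T f \<in> L2_space) \<and>
     (\<forall>f\<in>L1_space \<inter> L2_space. AE \<omega> in lebesgue. T f \<omega> = qpft_L1 \<Lambda> f \<omega>) \<and>
     (\<forall>f\<in>L2_space. \<forall>\<epsilon>>0. \<exists>\<delta>>0. \<forall>g\<in>L2_space.
        L2_norm (\<lambda>x. g x - f x) < \<delta> \<longrightarrow> L2_norm (\<lambda>\<omega>. T g \<omega> - T f \<omega>) < \<epsilon>)"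

text \<open>
  The extension is unique up to equality almost everywhere, because \<open>L\<^sup>1 \<inter> L\<^sup>2\<close> is dense in \<open>L\<^sup>2\<close>;
  the choice below only picks representatives. That an extension exists (for \<open>b\<^sub>k \<noteq> 0\<close>) is not
  built into the definition.
\<close>

definition qpft_L2 ::
    "('n::finite \<Rightarrow> qpft_param) \<Rightarrow> (real ^ 'n \<Rightarrow> complex) \<Rightarrow> real ^ 'n \<Rightarrow> complex" where
  "qpft_L2 \<Lambda> = (SOME T. is_continuous_qpft_extension \<Lambda> T)"

end

theory Submission
  imports Defs "HOL-Probability.Characteristic_Functions"
begin

text \<open>
  The transform factors as multiplication by a chirp, a Fourier integral with the bilinear phase
  \<open>\<Sum>k. b\<^sub>k x\<^sub>k \<omega>\<^sub>k\<close>, and multiplication by another chirp times a constant. Chirps have modulus one,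
  and the modulus of the constant is the square root of the factor \<open>\<Prod>k. \<bar>b\<^sub>k\<bar> / 2\<pi>\<close> that normalises the Fourier
  integral. So the statement is Plancherel's theorem, together with the construction of the
  extension to \<open>L\<^sup>2\<close>.

  Plancherel's identity is only needed for continuous functions \<open>h\<close> of compact support
  (\<open>plancherel_Cc\<close>). Let \<open>F\<close> be the Fourier integral of \<open>h\<close>. Weighting \<open>\<bar>F\<bar>\<^sup>2\<close> by the Gaussian
  \<open>exp (- \<bar>\<omega>\<bar>\<^sup>2 / 2 s\<^sup>2)\<close> makes all integrals absolutely convergent, and Fubini's theorem turns the weighted
  integral into the constant \<open>\<Prod>k. 2\<pi> / \<bar>b\<^sub>k\<bar>\<close> times \<open>\<integral> h(x) \<integral> cnj (h(x + u / (b s))) \<gamma>(u) du dx\<close> with \<open>\<gamma>\<close> the standard normal density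
  (\<open>regularised_plancherel\<close>). For \<open>s \<rightarrow> \<infinity>\<close> the left-hand side converges by monotone convergence, the
  right-hand side by dominated convergence, and the double integral becomes the integral of \<open>\<bar>h\<bar>\<^sup>2\<close>.

  Functions of this kind are dense in \<open>L\<^sup>2\<close>, and a function in \<open>L\<^sup>1 \<inter> L\<^sup>2\<close> can be approximated in both
  norms by the same sequence (\<open>Cc_dense\<close>). The relation \<open>qpft_limit \<Lambda> f h\<close> says that \<open>h\<close> is an
  \<open>L\<^sup>2\<close>-limit of transforms of such functions approximating \<open>f\<close>. It is linear and isometric because
  the transform is so on the dense subspace; by completeness of \<open>L\<^sup>2\<close> every \<open>f\<close> has such an \<open>h\<close>, and
  the approximation in both norms shows that \<open>h\<close> is the integral transform when \<open>f\<close> is integrable.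
  Hence a continuous extension exists. Conversely any continuous extension maps \<open>f\<close> to
  such an \<open>h\<close> (\<open>qpft_extension_limit\<close>), so it preserves norms of linear combinations, and
  polarisation gives the equality of inner products.
\<close>

section \<open>Square-integrable functions\<close>

lemma L2_measurable: "f \<in> L2_space \<Longrightarrow> f \<in> borel_measurable lebesgue"
  by (simp add: L2_space_def)

lemma L2_square_integrable: "f \<in> L2_space \<Longrightarrow> integrable lebesgue (\<lambda>x. (norm (f x))\<^sup>2)"
  by (simp add: L2_space_def)

lemma norm_add_square_le: "(norm (a + b :: complex))\<^sup>2 \<le> 2 * (norm a)\<^sup>2 + 2 * (norm b)\<^sup>2"
proof -
  have "(norm (a + b))\<^sup>2 \<le> (norm a + norm b)\<^sup>2"
    by (intro power_mono norm_triangle_ineq) auto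
  also have "\<dots> \<le> 2 * (norm a)\<^sup>2 + 2 * (norm b)\<^sup>2"
    using sum_squares_bound[of "norm a" "norm b"] by (simp add: power2_sum)
  finally show ?thesis .
qed

lemma L2_add:
  assumes f: "f \<in> L2_space" and g: "g \<in> L2_space"
  shows "(\<lambda>x. f x + g x) \<in> L2_space"
proof -
  note [measurable] = L2_measurable[OF f] L2_measurable[OF g]
  have "integrable lebesgue (\<lambda>x. (norm (f x + g x))\<^sup>2)"
  proof (rule Bochner_Integration.integrable_bound)
    show "integrable lebesgue (\<lambda>x. 2 * (norm (f x))\<^sup>2 + 2 * (norm (g x))\<^sup>2)"
      using L2_square_integrable[OF f] L2_square_integrable[OF g] by auto
    show "AE x in lebesgue. norm ((norm (f x + g x))\<^sup>2) \<le> norm (2 * (norm (f x))\<^sup>2 + 2 * (norm (g x))\<^sup>2)"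
      using norm_add_square_le by auto
  qed measurable
  then show ?thesis by (simp add: L2_space_def)
qed

lemma L2_cmult:
  assumes f: "f \<in> L2_space"
  shows "(\<lambda>x. c * f x) \<in> L2_space"
  using L2_measurable[OF f] L2_square_integrable[OF f]
  by (auto simp: L2_space_def norm_mult power_mult_distrib)

lemma L2_diff:
  assumes f: "f \<in> L2_space" and g: "g \<in> L2_space"
  shows "(\<lambda>x. f x - g x) \<in> L2_space"
  using L2_add[OF f L2_cmult[OF g, of "-1"]] by simp

lemma L2_norm_nonneg: "0 \<le> L2_norm f"
  by (simp add: L2_norm_def)

lemma L2_norm_power2: "(L2_norm f)\<^sup>2 = (LINT x|lebesgue. (norm (f x))\<^sup>2)"
  by (simp add: L2_norm_def)

lemma L2_norm_cong_AE:
  assumes "f \<in> borel_measurable lebesgue" "g \<in> borel_measurable lebesgue"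
    and "AE x in lebesgue. f x = g x"
  shows "L2_norm f = L2_norm g"
proof -
  have "(LINT x|lebesgue. (norm (f x))\<^sup>2) = (LINT x|lebesgue. (norm (g x))\<^sup>2)"
    by (rule integral_cong_AE) (use assms in auto)
  then show ?thesis by (simp add: L2_norm_def)
qed

lemma L2_norm_cmult: "L2_norm (\<lambda>x. c * f x) = norm c * L2_norm f"
  by (simp add: L2_norm_def norm_mult power_mult_distrib real_sqrt_mult)

lemma L2_norm_minus_commute: "L2_norm (\<lambda>x. f x - g x) = L2_norm (\<lambda>x. g x - f x)"
  by (simp add: L2_norm_def norm_minus_commute)

lemma L2_mult_integrable:
  assumes f: "f \<in> L2_space" and g: "g \<in> L2_space"
  shows "integrable lebesgue (\<lambda>x. norm (f x) * norm (g x))"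
proof -
  note [measurable] = L2_measurable[OF f] L2_measurable[OF g]
  show ?thesis
  proof (rule Bochner_Integration.integrable_bound)
    show "integrable lebesgue (\<lambda>x. (norm (f x))\<^sup>2 + (norm (g x))\<^sup>2)"
      using L2_square_integrable[OF f] L2_square_integrable[OF g] by auto
    show "AE x in lebesgue. norm (norm (f x) * norm (g x)) \<le> norm ((norm (f x))\<^sup>2 + (norm (g x))\<^sup>2)"
    proof (rule AE_I2)
      fix x
      have "2 * (norm (f x) * norm (g x)) \<le> (norm (f x))\<^sup>2 + (norm (g x))\<^sup>2"
        using sum_squares_bound[of "norm (f x)" "norm (g x)"] by (simp add: mult.assoc)
      then show "norm (norm (f x) * norm (g x)) \<le> norm ((norm (f x))\<^sup>2 + (norm (g x))\<^sup>2)"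
        by (simp add: abs_mult)
          (smt (verit) mult_nonneg_nonneg norm_ge_zero)
    qed
  qed measurable
qed

text \<open>
  Both square integrals are finite, so the inequality for integrals with values in the extended
  nonnegative reals carries over to real numbers.
\<close>

lemma L2_cauchy_schwarz:
  assumes f: "f \<in> L2_space" and g: "g \<in> L2_space"
  shows "(LINT x|lebesgue. norm (f x) * norm (g x)) \<le> L2_norm f * L2_norm g"
proof -
  note [measurable] = L2_measurable[OF f] L2_measurable[OF g]
  have sq: "(\<integral>\<^sup>+x. (ennreal (norm (k x)))\<^sup>2 \<partial>lebesgue) = ennreal ((L2_norm k)\<^sup>2)" if "k \<in> L2_space" for k
    unfolding L2_norm_power2
    using nn_integral_eq_integral[OF L2_square_integrable[OF that]] by (simp add: ennreal_power)
  have "(\<integral>\<^sup>+x. ennreal (norm (f x)) * ennreal (norm (g x)) \<partial>lebesgue) =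
      ennreal (LINT x|lebesgue. norm (f x) * norm (g x))"
    using nn_integral_eq_integral[OF L2_mult_integrable[OF f g]] by (simp add: ennreal_mult)
  then have "(ennreal (LINT x|lebesgue. norm (f x) * norm (g x)))\<^sup>2 \<le>
      ennreal ((L2_norm f)\<^sup>2) * ennreal ((L2_norm g)\<^sup>2)"
    using Cauchy_Schwarz_nn_integral[of "\<lambda>x. ennreal (norm (f x))" lebesgue "\<lambda>x. ennreal (norm (g x))"]
    by (simp add: sq f g)
  then have "(LINT x|lebesgue. norm (f x) * norm (g x))\<^sup>2 \<le> (L2_norm f * L2_norm g)\<^sup>2"
    by (simp add: ennreal_power power_mult_distrib flip: ennreal_mult)
  then show ?thesis
    by (rule power2_le_imp_le) (simp add: L2_norm_nonneg)
qed

lemma L2_triangle: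
  assumes f: "f \<in> L2_space" and g: "g \<in> L2_space"
  shows "L2_norm (\<lambda>x. f x + g x) \<le> L2_norm f + L2_norm g"
proof (rule power2_le_imp_le)
  note I = L2_square_integrable[OF f] L2_square_integrable[OF g] L2_mult_integrable[OF f g]
  have I2: "integrable lebesgue (\<lambda>x. 2 * (norm (f x) * norm (g x)))"
    by (rule integrable_mult_right) (rule I)
  have "(L2_norm (\<lambda>x. f x + g x))\<^sup>2 \<le>
      (LINT x|lebesgue. ((norm (f x))\<^sup>2 + (norm (g x))\<^sup>2) + 2 * (norm (f x) * norm (g x)))"
    unfolding L2_norm_power2
  proof (rule integral_mono)
    show "(norm (f x + g x))\<^sup>2 \<le> ((norm (f x))\<^sup>2 + (norm (g x))\<^sup>2) + 2 * (norm (f x) * norm (g x))" for x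
      using power_mono[OF norm_triangle_ineq[of "f x" "g x"], of 2] by (simp add: power2_sum mult.assoc)
  qed (use I I2 L2_square_integrable[OF L2_add[OF f g]] in \<open>auto intro!: Bochner_Integration.integrable_add\<close>)
  also have "\<dots> = (L2_norm f)\<^sup>2 + (L2_norm g)\<^sup>2 + 2 * (LINT x|lebesgue. norm (f x) * norm (g x))"
    using I I2 by (simp add: L2_norm_power2)
  also have "\<dots> \<le> (L2_norm f)\<^sup>2 + (L2_norm g)\<^sup>2 + 2 * (L2_norm f * L2_norm g)"
    using L2_cauchy_schwarz[OF f g] by simp
  finally show "(L2_norm (\<lambda>x. f x + g x))\<^sup>2 \<le> (L2_norm f + L2_norm g)\<^sup>2"
    by (simp add: power2_sum mult.assoc)
qed (simp add: L2_norm_nonneg)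

lemma L2_triangle_sub:
  assumes f: "f \<in> L2_space" and g: "g \<in> L2_space" and h: "h \<in> L2_space"
  shows "L2_norm (\<lambda>x. f x - h x) \<le> L2_norm (\<lambda>x. f x - g x) + L2_norm (\<lambda>x. g x - h x)"
  using L2_triangle[OF L2_diff[OF f g] L2_diff[OF g h]] by simp

lemma L2_norm_diff_le:
  assumes f: "f \<in> L2_space" and g: "g \<in> L2_space"
  shows "\<bar>L2_norm f - L2_norm g\<bar> \<le> L2_norm (\<lambda>x. f x - g x)"
  using L2_triangle[OF L2_diff[OF f g] g] L2_triangle[OF L2_diff[OF g f] f]
    L2_norm_minus_commute[of f g] by simp

lemma L2_norm_tendsto:
  assumes u: "\<And>n. u n \<in> L2_space" and f: "f \<in> L2_space"
    and lim: "(\<lambda>n. L2_norm (\<lambda>x. u n x - f x)) \<longlonglongrightarrow> 0"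
  shows "(\<lambda>n. L2_norm (u n)) \<longlonglongrightarrow> L2_norm f"
proof (rule LIM_zero_cancel, rule Lim_null_comparison[OF _ lim])
  show "\<forall>\<^sub>F n in sequentially. norm (L2_norm (u n) - L2_norm f) \<le> L2_norm (\<lambda>x. u n x - f x)"
    using L2_norm_diff_le[OF u f] by simp
qed

text \<open>
  An \<open>L\<^sup>2\<close>-convergent sequence has a subsequence that converges almost everywhere to the same limit.
\<close>

lemma L2_limit_eq_pointwise_limit:
  assumes u: "\<And>n. u n \<in> L2_space" and h: "h \<in> L2_space"
    and lim: "(\<lambda>n. L2_norm (\<lambda>x. u n x - h x)) \<longlonglongrightarrow> 0"
    and v: "AE x in lebesgue. (\<lambda>n. u n x) \<longlonglongrightarrow> v x"
  shows "AE x in lebesgue. h x = v x"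
proof -
  have "(\<lambda>n. (L2_norm (\<lambda>x. u n x - h x))\<^sup>2) \<longlonglongrightarrow> 0\<^sup>2"
    by (intro tendsto_intros lim)
  then have "(\<lambda>n. LINT x|lebesgue. norm ((norm (u n x - h x))\<^sup>2)) \<longlonglongrightarrow> 0"
    by (simp add: L2_norm_power2)
  from tendsto_L1_AE_subseq[OF L2_square_integrable[OF L2_diff[OF u h]] this]
  obtain r :: "nat \<Rightarrow> nat" where r: "strict_mono r"
    and ae: "AE x in lebesgue. (\<lambda>n. (norm (u (r n) x - h x))\<^sup>2) \<longlonglongrightarrow> 0" by blast
  from ae v show ?thesis
  proof eventually_elim
    case (elim x)
    have "(\<lambda>n. sqrt ((norm (u (r n) x - h x))\<^sup>2)) \<longlonglongrightarrow> sqrt 0"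
      by (intro tendsto_intros elim)
    then have "(\<lambda>n. u (r n) x - h x) \<longlonglongrightarrow> 0"
      by (simp add: tendsto_norm_zero_iff)
    then have "(\<lambda>n. u (r n) x) \<longlonglongrightarrow> h x" by (rule LIM_zero_cancel)
    moreover have "(\<lambda>n. u (r n) x) \<longlonglongrightarrow> v x"
      using LIMSEQ_subseq_LIMSEQ[OF elim(2) r] by (simp add: o_def)
    ultimately show ?case by (rule LIMSEQ_unique)
  qed
qed

text \<open>
  Four norms determine the inner product, so an isometry that respects linear combinations preserves
  inner products.
\<close>

lemma L2_inner_polarisation:
  assumes f: "f \<in> L2_space" and g: "g \<in> L2_space"
  shows "L2_inner f g =
    (\<Sum>c\<in>{1, -1, \<i>, -\<i>}. c * of_real ((L2_norm (\<lambda>x. f x + c * g x))\<^sup>2)) / 4"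
proof -
  have I: "complex_integrable lebesgue (\<lambda>x. of_real ((norm (f x + c * g x))\<^sup>2))" for c
    using L2_square_integrable[OF L2_add[OF f L2_cmult[OF g, of c]]] by (rule integrable_of_real)
  have p: "a * cnj b = (\<Sum>c\<in>{1, -1, \<i>, -\<i>}. c * of_real ((norm (a + c * b))\<^sup>2)) / 4" for a b
    by (simp add: complex_eq_iff cmod_power2 del: of_real_power) (simp add: power2_eq_square algebra_simps)
  have "L2_inner f g = (LINT x|lebesgue. (\<Sum>c\<in>{1, -1, \<i>, -\<i>}. c * of_real ((norm (f x + c * g x))\<^sup>2)) / 4)"
    unfolding L2_inner_def p[symmetric] ..
  also have "\<dots> = (\<Sum>c\<in>{1, -1, \<i>, -\<i>}. LINT x|lebesgue. c * of_real ((norm (f x + c * g x))\<^sup>2)) / 4"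
    unfolding integral_divide_zero
    by (subst Bochner_Integration.integral_sum) (use I in \<open>auto intro!: integrable_mult_right\<close>)
  also have "\<dots> = (\<Sum>c\<in>{1, -1, \<i>, -\<i>}. c * of_real ((L2_norm (\<lambda>x. f x + c * g x))\<^sup>2)) / 4"
    by (simp only: integral_mult_right_zero integral_complex_of_real L2_norm_power2)
  finally show ?thesis .
qed

section \<open>Completeness of the space of square-integrable functions\<close>

text \<open>
  The terms of the weighted series are bounded, so the increments are bounded by a geometric sequence
  of ratio \<open>1 / sqrt 2\<close>. This is how square-integrability of increments yields pointwise
  convergence below.
\<close>

lemma convergent_if_geometric_weights_summable:
  fixes a :: "nat \<Rightarrow> complex"
  assumes "(\<Sum>k. ennreal (2 ^ k * (norm (a (Suc k) - a k))\<^sup>2)) < \<infinity>"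
  shows "convergent a"
proof -
  have "summable (\<lambda>k. 2 ^ k * (norm (a (Suc k) - a k))\<^sup>2)"
    by (rule summable_suminf_not_top) (use assms in auto)
  then have "(\<lambda>k. 2 ^ k * (norm (a (Suc k) - a k))\<^sup>2) \<longlonglongrightarrow> 0"
    by (rule summable_LIMSEQ_zero)
  then have "Bseq (\<lambda>k. 2 ^ k * (norm (a (Suc k) - a k))\<^sup>2)"
    by (intro convergent_imp_Bseq convergentI)
  then obtain C where C: "\<And>k. norm (2 ^ k * (norm (a (Suc k) - a k))\<^sup>2) \<le> C"
    unfolding Bseq_def by blast
  have b: "norm (a (Suc k) - a k) \<le> sqrt C * (1 / sqrt 2) ^ k" for k
  proof -
    have "(norm (a (Suc k) - a k))\<^sup>2 \<le> C * (1 / 2) ^ k"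
      using C[of k] by (simp add: field_simps power_divide)
    then have "sqrt ((norm (a (Suc k) - a k))\<^sup>2) \<le> sqrt (C * (1 / 2) ^ k)"
      by (rule real_sqrt_le_mono)
    then show ?thesis by (simp add: real_sqrt_mult real_sqrt_power real_sqrt_divide)
  qed
  have "summable (\<lambda>k. sqrt C * (1 / sqrt 2) ^ k)"
    by (intro summable_mult summable_geometric) simp
  then have "summable (\<lambda>k. a (Suc k) - a k)"
    by (rule summable_comparison_test'[where N=0]) (rule b)
  then have "convergent (\<lambda>n. \<Sum>k<n. a (Suc k) - a k)"
    by (simp add: summable_iff_convergent)
  then have "convergent (\<lambda>n. a n - a 0)"
    by (simp add: sum_lessThan_telescope)
  then have "convergent (\<lambda>n. (a n - a 0) + a 0)"
    by (rule convergent_add) (rule convergent_const)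
  then show ?thesis by simp
qed

text \<open>
  The Riesz-Fischer theorem. Along a subsequence whose increments have norm at most \<open>2\<^sup>-\<^sup>k\<close>, the series
  of squared increments with weights \<open>2\<^sup>k\<close> has a finite integral; hence the subsequence converges almost
  everywhere. Fatou's lemma bounds the \<open>L\<^sup>2\<close>-distance to the pointwise limit.
\<close>

lemma L2_complete:
  assumes u: "\<And>n. u n \<in> L2_space"
    and cauchy: "\<And>e. e > 0 \<Longrightarrow> \<exists>N. \<forall>m\<ge>N. \<forall>n\<ge>N. L2_norm (\<lambda>x. u m x - u n x) < e"
  obtains h where "h \<in> L2_space" "(\<lambda>n. L2_norm (\<lambda>x. u n x - h x)) \<longlonglongrightarrow> 0"
proof -
  note [measurable] = L2_measurable[OF u]
  have nn: "(\<integral>\<^sup>+x. ennreal ((norm (u m x - u n x))\<^sup>2) \<partial>lebesgue) = ennreal ((L2_norm (\<lambda>x. u m x - u n x))\<^sup>2)" for m n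
    unfolding L2_norm_power2
    by (rule nn_integral_eq_integral[OF L2_square_integrable[OF L2_diff[OF u u]]]) simp
  have "\<forall>k. \<exists>N. \<forall>m\<ge>N. \<forall>n\<ge>N. L2_norm (\<lambda>x. u m x - u n x) < (1 / 2) ^ k"
    using cauchy by simp
  then obtain N where N: "\<And>k m n. m \<ge> N k \<Longrightarrow> n \<ge> N k \<Longrightarrow> L2_norm (\<lambda>x. u m x - u n x) < (1 / 2) ^ k"
    by metis
  \<comment> \<open>The sum makes the index monotone and at least \<open>N k\<close>; the summand \<open>k\<close> makes it unbounded.\<close>
  define r where "r k = k + (\<Sum>j\<le>k. N j)" for k
  have rN: "r k \<ge> N k" for k
    unfolding r_def using member_le_sum[of k "{..k}" N] by simp
  have rmono: "r k \<le> r (Suc k)" for k by (simp add: r_def)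
  have rk: "r k \<ge> k" for k by (simp add: r_def)
  have small: "(L2_norm (\<lambda>x. u (r (Suc k)) x - u (r k) x))\<^sup>2 \<le> (1 / 4) ^ k" for k
  proof -
    have "L2_norm (\<lambda>x. u (r (Suc k)) x - u (r k) x) \<le> (1 / 2) ^ k"
      using N[of k "r (Suc k)" "r k"] rN[of k] rmono[of k] by simp
    from power_mono[OF this L2_norm_nonneg, of 2] show ?thesis
      by (simp add: power_divide power2_eq_square flip: power_mult_distrib)
  qed
  have "(\<integral>\<^sup>+x. (\<Sum>k. ennreal (2 ^ k * (norm (u (r (Suc k)) x - u (r k) x))\<^sup>2)) \<partial>lebesgue) =
      (\<Sum>k. \<integral>\<^sup>+x. ennreal (2 ^ k * (norm (u (r (Suc k)) x - u (r k) x))\<^sup>2) \<partial>lebesgue)"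
    by (rule nn_integral_suminf) measurable
  also have "\<dots> = (\<Sum>k. ennreal (2 ^ k * (L2_norm (\<lambda>x. u (r (Suc k)) x - u (r k) x))\<^sup>2))"
    by (simp add: ennreal_mult nn_integral_cmult nn)
  also have "\<dots> \<le> (\<Sum>k. ennreal ((1 / 2) ^ k))"
  proof (intro suminf_le ennreal_leI)
    fix k
    have "2 ^ k * (L2_norm (\<lambda>x. u (r (Suc k)) x - u (r k) x))\<^sup>2 \<le> 2 ^ k * (1 / 4) ^ k"
      using small[of k] by (intro mult_left_mono) auto
    then show "2 ^ k * (L2_norm (\<lambda>x. u (r (Suc k)) x - u (r k) x))\<^sup>2 \<le> (1 / 2) ^ k"
      by (simp flip: power_mult_distrib)
  qed auto
  also have "\<dots> < \<infinity>"
    by (subst suminf_ennreal2) (auto simp: summable_geometric)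
  finally have "AE x in lebesgue. (\<Sum>k. ennreal (2 ^ k * (norm (u (r (Suc k)) x - u (r k) x))\<^sup>2)) \<noteq> \<infinity>"
    by (intro nn_integral_PInf_AE) auto
  then have conv: "AE x in lebesgue. convergent (\<lambda>k. u (r k) x)"
  proof eventually_elim
    case (elim x)
    then show ?case
      by (intro convergent_if_geometric_weights_summable) (simp add: top.not_eq_extremum)
  qed
  define h where "h x = lim (\<lambda>k. u (r k) x)" for x
  have [measurable]: "h \<in> borel_measurable lebesgue"
    unfolding h_def by measurable
  have fatou: "(\<integral>\<^sup>+x. ennreal ((norm (u n x - h x))\<^sup>2) \<partial>lebesgue) \<le> ennreal (((1 / 2) ^ j)\<^sup>2)"
    if n: "n \<ge> N j" for n j
  proof -
    have "(\<integral>\<^sup>+x. ennreal ((norm (u n x - h x))\<^sup>2) \<partial>lebesgue) =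
        (\<integral>\<^sup>+x. liminf (\<lambda>k. ennreal ((norm (u n x - u (r k) x))\<^sup>2)) \<partial>lebesgue)"
    proof (rule nn_integral_cong_AE)
      show "AE x in lebesgue. ennreal ((norm (u n x - h x))\<^sup>2) = liminf (\<lambda>k. ennreal ((norm (u n x - u (r k) x))\<^sup>2))"
        using conv
      proof eventually_elim
        case (elim x)
        then have "(\<lambda>k. u (r k) x) \<longlonglongrightarrow> h x"
          by (simp add: h_def convergent_LIMSEQ_iff)
        then have "(\<lambda>k. ennreal ((norm (u n x - u (r k) x))\<^sup>2)) \<longlonglongrightarrow> ennreal ((norm (u n x - h x))\<^sup>2)"
          by (intro tendsto_intros)
        then show ?case by (rule lim_imp_Liminf[symmetric, rotated]) simp
      qed
    qed
    also have "\<dots> \<le> liminf (\<lambda>k. \<integral>\<^sup>+x. ennreal ((norm (u n x - u (r k) x))\<^sup>2) \<partial>lebesgue)"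
      by (rule nn_integral_liminf) measurable
    also have "\<dots> \<le> liminf (\<lambda>k. ennreal (((1 / 2) ^ j)\<^sup>2))"
    proof (rule Liminf_mono)
      show "\<forall>\<^sub>F k in sequentially. (\<integral>\<^sup>+x. ennreal ((norm (u n x - u (r k) x))\<^sup>2) \<partial>lebesgue) \<le> ennreal (((1 / 2) ^ j)\<^sup>2)"
        using eventually_ge_at_top[of "N j"]
      proof eventually_elim
        case (elim k)
        then have "L2_norm (\<lambda>x. u n x - u (r k) x) \<le> (1 / 2) ^ j"
          using N[of j n "r k"] n rk[of k] by simp
        then show ?case unfolding nn by (intro ennreal_leI power_mono L2_norm_nonneg)
      qed
    qed
    also have "\<dots> = ennreal (((1 / 2) ^ j)\<^sup>2)" by (simp add: Liminf_const)
    finally show ?thesis .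
  qed
  have d: "(\<lambda>x. u n x - h x) \<in> L2_space" if "n \<ge> N j" for n j
  proof -
    have "integrable lebesgue (\<lambda>x. (norm (u n x - h x))\<^sup>2)"
    proof (rule integrableI_bounded)
      show "(\<integral>\<^sup>+x. ennreal (norm ((norm (u n x - h x))\<^sup>2)) \<partial>lebesgue) < \<infinity>"
        using le_less_trans[OF fatou[OF that] ennreal_less_top] by simp
    qed measurable
    then show ?thesis by (simp add: L2_space_def)
  qed
  \<comment> \<open>A difference of two square-integrable functions that equals \<open>h\<close>.\<close>
  have "(\<lambda>x. u (N 0) x - (u (N 0) x - h x)) \<in> L2_space"
    by (rule L2_diff[OF u d[of 0]]) simp
  then have h: "h \<in> L2_space" by simp
  have bound: "L2_norm (\<lambda>x. u n x - h x) \<le> (1 / 2) ^ j" if "n \<ge> N j" for n j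
  proof -
    have "ennreal ((L2_norm (\<lambda>x. u n x - h x))\<^sup>2) \<le> ennreal (((1 / 2) ^ j)\<^sup>2)"
      using fatou[OF that] nn_integral_eq_integral[OF L2_square_integrable[OF L2_diff[OF u h]]]
      by (simp add: L2_norm_power2)
    then have "(L2_norm (\<lambda>x. u n x - h x))\<^sup>2 \<le> ((1 / 2) ^ j)\<^sup>2"
      by (subst (asm) ennreal_le_iff) auto
    then show ?thesis by (rule power2_le_imp_le) simp
  qed
  have "(\<lambda>n. L2_norm (\<lambda>x. u n x - h x)) \<longlonglongrightarrow> 0"
  proof (rule LIMSEQ_I)
    fix e :: real assume "e > 0"
    then obtain j where j: "(1 / 2) ^ j < e" using real_arch_pow_inv[of e "1 / 2"] by auto
    have "norm (L2_norm (\<lambda>x. u n x - h x) - 0) < e" if "n \<ge> N j" for n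
      using le_less_trans[OF bound[OF that] j] by (simp add: L2_norm_nonneg)
    then show "\<exists>N. \<forall>n\<ge>N. norm (L2_norm (\<lambda>x. u n x - h x) - 0) < e" by blast
  qed
  with h show thesis by (rule that)
qed

section \<open>Fourier integrals of Gaussians\<close>

text \<open>
  Fubini's theorem: a bounded kernel can be moved from one function to the other. For the Fourier
  kernel this is the multiplication formula \<open>\<integral> f\<^sup>^ g = \<integral> f g\<^sup>^\<close>.
\<close>

lemma multiplication_formula:
  fixes k :: "'a::euclidean_space \<Rightarrow> 'b::euclidean_space \<Rightarrow> complex"
  assumes k [measurable]: "case_prod k \<in> borel_measurable (lborel \<Otimes>\<^sub>M lborel)"
    and k1: "\<And>x w. norm (k x w) \<le> 1"
    and f: "integrable lborel f" and g: "integrable lborel g"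
  shows "(LINT w|lborel. (LINT x|lborel. k x w * f x) * g w) =
         (LINT x|lborel. f x * (LINT w|lborel. k x w * g w))"
proof -
  have [measurable]: "f \<in> borel_measurable lborel" "g \<in> borel_measurable lborel"
    using f g by auto
  have fg: "integrable (lborel \<Otimes>\<^sub>M lborel) (\<lambda>(x, w). f x * g w)"
    by (rule lborel_pair.Fubini_integrable)
       (use f g in \<open>auto simp: norm_mult\<close>)
  have "integrable (lborel \<Otimes>\<^sub>M lborel) (\<lambda>(x, w). k x w * f x * g w)"
  proof (rule Bochner_Integration.integrable_bound[OF fg])
    show "AE p in lborel \<Otimes>\<^sub>M lborel. norm (case p of (x, w) \<Rightarrow> k x w * f x * g w) \<le>
            norm (case p of (x, w) \<Rightarrow> f x * g w)"
    proof (rule AE_I2, clarify)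
      fix x w
      have "norm (k x w) * norm (f x * g w) \<le> 1 * norm (f x * g w)"
        by (rule mult_right_mono) (auto simp: k1)
      then show "norm (k x w * f x * g w) \<le> norm (f x * g w)"
        by (simp add: norm_mult mult.assoc)
    qed
  qed measurable
  then have "(LINT w|lborel. LINT x|lborel. k x w * f x * g w) =
             (LINT x|lborel. LINT w|lborel. k x w * f x * g w)"
    by (rule lborel_pair.Fubini_integral)
  moreover have "(LINT x|lborel. k x w * f x * g w) = (LINT x|lborel. k x w * f x) * g w" for w
    by simp
  moreover have "(LINT w|lborel. k x w * f x * g w) = f x * (LINT w|lborel. k x w * g w)" for x
    by (subst integral_mult_right_zero[symmetric]) (simp add: ac_simps)
  ultimately show ?thesis by simp
qed

lemma prod_Basis_vec:
  "(\<Prod>b\<in>(Basis :: (real^'n::finite) set). F b) = (\<Prod>k\<in>UNIV. F (axis k 1))"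
proof -
  have B: "(Basis :: (real^'n) set) = (\<lambda>k. axis k 1) ` UNIV"
    by (auto simp: Basis_vec_def)
  show ?thesis
    unfolding B by (subst prod.reindex) (auto simp: inj_on_def axis_eq_axis)
qed

text \<open>
  Lebesgue measure on \<open>real^'n\<close> is by construction the image of a product measure indexed by the basis
  vectors; the functions are therefore transported from coordinates to basis vectors.
\<close>

lemma lborel_vec_integral_prod:
  fixes f :: "'n::finite \<Rightarrow> real \<Rightarrow> 'b::{real_normed_field,banach,second_countable_topology}"
  assumes f: "\<And>k. integrable lborel (f k)"
  shows "integrable lborel (\<lambda>x::real^'n. \<Prod>k\<in>UNIV. f k (x $ k))" (is ?thesis1)
    and "(LINT x|lborel. (\<Prod>k\<in>UNIV. f k ((x::real^'n) $ k))) = (\<Prod>k\<in>UNIV. integral\<^sup>L lborel (f k))" (is ?thesis2)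
proof -
  interpret product_sigma_finite "\<lambda>_::real^'n. lborel :: real measure" ..
  have [measurable]: "f k \<in> borel_measurable borel" for k
    using f[of k] by auto
  \<comment> \<open>The family \<open>f\<close>, reindexed by the basis vectors.\<close>
  define F where "F b = f (THE k. b = axis k (1::real))" for b :: "real^'n"
  have [simp]: "F (axis k 1) = f k" for k
    by (simp add: F_def axis_eq_axis)
  have F: "integrable lborel (F b)" if "b \<in> Basis" for b
    using that f by (auto simp: Basis_vec_def)
  define T where "T g = (\<Sum>b\<in>Basis. g b *\<^sub>R b)" for g :: "real^'n \<Rightarrow> real"
  have [measurable]: "T \<in> (\<Pi>\<^sub>M b\<in>Basis. lborel) \<rightarrow>\<^sub>M borel"
    unfolding T_def by measurable
  have eq: "(lborel :: (real^'n) measure) = distr (\<Pi>\<^sub>M b\<in>Basis. lborel) borel T"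
    unfolding T_def[abs_def] by (rule lborel_eq)
  have T: "T g $ k = g (axis k 1)" for g k
  proof -
    have "T g \<bullet> axis k 1 = g (axis k 1)"
      unfolding T_def by (rule inner_sum_left_Basis) (auto simp: Basis_vec_def)
    then show ?thesis by (simp add: inner_axis)
  qed
  have m [measurable]: "(\<lambda>x::real^'n. \<Prod>k\<in>UNIV. f k (x $ k)) \<in> borel_measurable borel"
    by measurable
  have e: "(\<Prod>k\<in>UNIV. f k (T g $ k)) = (\<Prod>b\<in>Basis. F b (g b))" for g
    by (simp add: prod_Basis_vec T)
  show ?thesis1
    unfolding eq by (subst integrable_distr_eq) (auto simp: e intro!: product_integrable_prod F)
  show ?thesis2
  proof -
    have "(LINT x|lborel. (\<Prod>k\<in>UNIV. f k ((x::real^'n) $ k))) =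
        (LINT g|(\<Pi>\<^sub>M b\<in>(Basis::(real^'n) set). lborel). (\<Prod>b\<in>Basis. F b (g b)))"
      unfolding eq by (subst integral_distr) (simp_all add: e)
    also have "\<dots> = (\<Prod>b\<in>Basis. integral\<^sup>L lborel (F b))"
      by (rule product_integral_prod) (auto intro: F)
    finally show ?thesis by (simp add: prod_Basis_vec)
  qed
qed

text \<open>
  Rescaling reduces this to the characteristic function of the standard normal distribution.
  The value is written with \<open>std_normal_density\<close>, since it serves as an approximate identity later.
\<close>

lemma gaussian_fourier:
  fixes s t :: real
  assumes s: "s > 0"
  shows "integrable lborel (\<lambda>w. exp (\<i> * of_real (t * w)) * of_real (exp (- (w / s)\<^sup>2 / 2)))"
    and "(LINT w|lborel. exp (\<i> * of_real (t * w)) * of_real (exp (- (w / s)\<^sup>2 / 2))) =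
      complex_of_real (2 * pi * s * std_normal_density (t * s))"
proof -
  have nd: "exp (- (w / s)\<^sup>2 / 2) = sqrt (2 * pi) * std_normal_density (w / s)" for w :: real
    by (simp add: std_normal_density_def)
  have nd': "complex_of_real (exp (- (w\<^sup>2 / 2))) =
      complex_of_real (sqrt (2 * pi)) * complex_of_real (std_normal_density w)" for w :: real
    using nd[of "s * w"] s by (simp flip: of_real_mult)
  have "integrable lborel (\<lambda>w. normal_density 0 s w)" using s by simp
  then have "integrable lborel (\<lambda>w. complex_of_real (sqrt (2 * pi) * s * normal_density 0 s w))"
    by (intro integrable_of_real) auto
  moreover have "sqrt (2 * pi) * s * normal_density 0 s w = exp (- (w / s)\<^sup>2 / 2)" for w :: real
    using s by (simp add: normal_density_def real_sqrt_mult power_divide)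
  ultimately have i: "integrable lborel (\<lambda>w. complex_of_real (exp (- (w / s)\<^sup>2 / 2)))" by simp
  show "integrable lborel (\<lambda>w. exp (\<i> * of_real (t * w)) * of_real (exp (- (w / s)\<^sup>2 / 2)))"
    by (rule Bochner_Integration.integrable_bound[OF i]) (auto simp: norm_mult)
  have "(LINT w|lborel. exp (\<i> * of_real (t * w)) * of_real (exp (- (w / s)\<^sup>2 / 2))) =
      \<bar>s\<bar> *\<^sub>R (LINT w|lborel. exp (\<i> * of_real (t * (s * w))) * of_real (exp (- ((s * w) / s)\<^sup>2 / 2)))"
    using s by (subst lborel_integral_real_affine[where c=s and t=0]) auto
  also have "(LINT w|lborel. exp (\<i> * of_real (t * (s * w))) * of_real (exp (- ((s * w) / s)\<^sup>2 / 2))) =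
      sqrt (2 * pi) * (LINT w|lborel. std_normal_density w *\<^sub>R exp (\<i> * of_real ((t * s) * w)))"
    using s by (subst integral_mult_right_zero[symmetric])
               (auto simp: nd' scaleR_conv_of_real ac_simps intro!: Bochner_Integration.integral_cong)
  also have "(LINT w|lborel. std_normal_density w *\<^sub>R exp (\<i> * of_real ((t * s) * w))) =
      char std_normal_distribution (t * s)"
    unfolding char_def by (subst integral_density) auto
  also have "\<dots> = complex_of_real (exp (- ((t * s)^2) / 2))"
    by (simp add: char_std_normal_distribution)
  also have "\<bar>s\<bar> *\<^sub>R (complex_of_real (sqrt (2 * pi)) * complex_of_real (exp (- ((t * s)^2) / 2))) =
     complex_of_real (2 * pi * s * std_normal_density (t * s))"
  proof -
    have "s * (sqrt (2 * pi) * exp (- ((t * s)^2) / 2)) = 2 * pi * s * std_normal_density (t * s)"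
    proof -
      have "sqrt (2 * pi) = 2 * pi * (1 / sqrt (2 * pi))"
        using real_div_sqrt[of "2 * pi"] by simp
      then have "s * (sqrt (2 * pi) * exp (- ((t * s)^2) / 2)) =
          s * (2 * pi * (1 / sqrt (2 * pi)) * exp (- ((t * s)^2) / 2))" by (simp only:)
      then show ?thesis by (simp only: std_normal_density_def mult_ac)
    qed
    then show ?thesis using s by (simp only: scaleR_conv_of_real abs_of_pos flip: of_real_mult)
  qed
  finally show "(LINT w|lborel. exp (\<i> * of_real (t * w)) * of_real (exp (- (w / s)\<^sup>2 / 2))) =
      complex_of_real (2 * pi * s * std_normal_density (t * s))" .
qed

definition plane_wave :: "('n::finite \<Rightarrow> real) \<Rightarrow> real^'n \<Rightarrow> real^'n \<Rightarrow> complex" where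
  "plane_wave b x w = exp (\<i> * of_real (\<Sum>k\<in>UNIV. b k * x $ k * w $ k))"

text \<open>
  A Gaussian cutoff in frequency space; it increases to 1 as the width \<open>s\<close> grows.
\<close>

definition gaussian_window :: "real \<Rightarrow> real^'n::finite \<Rightarrow> real" where
  "gaussian_window s w = (\<Prod>k\<in>UNIV. exp (- (w $ k / s)\<^sup>2 / 2))"

lemma plane_wave_measurable [measurable]:
  fixes b :: "'n::finite \<Rightarrow> real"
  shows "(\<lambda>p. plane_wave b (fst p) (snd p)) \<in> borel_measurable (lborel \<Otimes>\<^sub>M lborel)"
proof -
  have "continuous_on UNIV (\<lambda>p :: (real^'n) \<times> (real^'n). plane_wave b (fst p) (snd p))"
    unfolding plane_wave_def by (intro continuous_intros)
  then show ?thesis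
    unfolding lborel_prod by (simp add: borel_measurable_continuous_onI)
qed

lemma plane_wave_norm [simp]: "norm (plane_wave b x w) = 1"
  by (simp add: plane_wave_def)

text \<open>
  The double integral for \<open>\<bar>F\<bar>\<^sup>2\<close> depends on its two variables through their difference only, hence
  becomes a convolution.
\<close>

lemma plane_wave_diff: "plane_wave b x w * cnj (plane_wave b y w) = plane_wave b (x - y) w"
  unfolding plane_wave_def
  by (simp add: exp_cnj exp_add[symmetric] algebra_simps sum_subtractf)

lemma gaussian_window_measurable [measurable]: "gaussian_window s \<in> borel_measurable (borel :: (real^'n::finite) measure)"
proof -
  have "continuous_on UNIV (gaussian_window s :: real^'n \<Rightarrow> real)"
    unfolding gaussian_window_def divide_inverse by (intro continuous_intros)
  then show ?thesis by (rule borel_measurable_continuous_onI)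
qed

lemma borel_measurable_cnj [measurable (raw)]:
  "f \<in> borel_measurable M \<Longrightarrow> (\<lambda>x. cnj (f x)) \<in> borel_measurable M"
  by (rule measurable_compose[where N=borel])
     (auto intro!: borel_measurable_continuous_onI continuous_intros)

lemma gaussian_window_integrable:
  assumes "s > 0"
  shows "integrable lborel (\<lambda>w::real^'n::finite. complex_of_real (gaussian_window s w))"
proof -
  have "integrable lborel (\<lambda>w::real^'n. \<Prod>k\<in>UNIV. complex_of_real (exp (- (w $ k / s)\<^sup>2 / 2)))"
    by (rule lborel_vec_integral_prod(1)) (use gaussian_fourier(1)[OF assms, of 0] in simp)
  then show ?thesis by (simp add: gaussian_window_def)
qed

lemma gaussian_window_fourier:
  fixes z :: "real^'n::finite"
  assumes "s > 0"
  shows "(LINT w|lborel. plane_wave b z w * of_real (gaussian_window s w)) =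
    of_real (\<Prod>k\<in>UNIV. 2 * pi * s * std_normal_density (b k * z $ k * s))"
proof -
  have "(LINT w|lborel. plane_wave b z w * of_real (gaussian_window s w)) =
     (LINT w|lborel. (\<Prod>k\<in>UNIV. exp (\<i> * of_real (b k * z $ k * w $ k)) * of_real (exp (- (w $ k / s)\<^sup>2 / 2))))"
    by (simp add: plane_wave_def gaussian_window_def sum_distrib_left exp_sum prod.distrib)
  also have "\<dots> = (\<Prod>k\<in>UNIV. LINT t|lborel. exp (\<i> * of_real (b k * z $ k * t)) * of_real (exp (- (t / s)\<^sup>2 / 2)))"
    by (rule lborel_vec_integral_prod(2)) (rule gaussian_fourier(1)[OF assms])
  finally show ?thesis by (simp only: gaussian_fourier(2)[OF assms] of_real_prod)
qed

lemma lborel_integral_diagonal: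
  fixes g :: "real^'n::finite \<Rightarrow> 'b::{banach,second_countable_topology}"
  assumes c: "\<And>k. c k \<noteq> 0" and g [measurable]: "g \<in> borel_measurable borel"
  shows "(LINT y|lborel. g y) = (\<Prod>k\<in>UNIV. \<bar>c k\<bar>) *\<^sub>R (LINT u|lborel. g (t + (\<chi> k. c k * u $ k)))"
proof -
  \<comment> \<open>The scaling factors, reindexed by the basis vectors.\<close>
  define c' where "c' b = c (THE k. b = axis k (1::real))" for b :: "real^'n"
  have c'[simp]: "c' (axis k 1) = c k" for k
    by (simp add: c'_def axis_eq_axis)
  have nz: "c' j \<noteq> 0" if "j \<in> Basis" for j
    using that c by (auto simp: Basis_vec_def)
  define T where "T x = t + (\<Sum>j\<in>Basis. (c' j * (x \<bullet> j)) *\<^sub>R j)" for x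
  have [measurable]: "T \<in> borel \<rightarrow>\<^sub>M borel"
    unfolding T_def by measurable
  have T: "T x = t + (\<chi> k. c k * x $ k)" for x
  proof -
    have "(\<Sum>j\<in>Basis. (c' j * (x \<bullet> j)) *\<^sub>R j) $ k = c k * x $ k" for k
    proof -
      have "(\<Sum>j\<in>Basis. (c' j * (x \<bullet> j)) *\<^sub>R j) \<bullet> axis k 1 = c' (axis k 1) * (x \<bullet> axis k 1)"
        by (rule inner_sum_left_Basis) (auto simp: Basis_vec_def)
      then show ?thesis by (simp add: inner_axis)
    qed
    then show ?thesis by (simp add: T_def vec_eq_iff)
  qed
  have "(lborel :: (real^'n) measure) =
      density (distr lborel borel T) (\<lambda>_. ennreal (\<Prod>j\<in>Basis. \<bar>c' j\<bar>))"
    unfolding T_def[abs_def] by (rule lborel_affine_euclidean) (rule nz)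
  then have "(LINT y|lborel. g y) =
      (LINT y|density (distr lborel borel T) (\<lambda>_. ennreal (\<Prod>j\<in>Basis. \<bar>c' j\<bar>)). g y)"
    by simp
  also have "\<dots> = (LINT y|distr lborel borel T. (\<Prod>j\<in>Basis. \<bar>c' j\<bar>) *\<^sub>R g y)"
    by (rule integral_density) (auto intro!: prod_nonneg)
  also have "\<dots> = (LINT u|lborel. (\<Prod>j\<in>Basis. \<bar>c' j\<bar>) *\<^sub>R g (T u))"
    by (rule integral_distr) auto
  finally show ?thesis by (simp add: T prod_Basis_vec)
qed

section \<open>Continuous functions of compact support\<close>

definition Cc_space :: "('a::real_normed_vector \<Rightarrow> complex) set" where
  "Cc_space = {f. continuous_on UNIV f \<and> (\<exists>R. \<forall>x. R < norm x \<longrightarrow> f x = 0)}"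

lemma Cc_bounded:
  fixes h :: "'a::euclidean_space \<Rightarrow> complex"
  assumes "h \<in> Cc_space"
  obtains M where "M \<ge> 0" "\<And>x. norm (h x) \<le> M"
proof -
  obtain R where c: "continuous_on UNIV h" and R: "\<And>x. R < norm x \<Longrightarrow> h x = 0"
    using assms by (auto simp: Cc_space_def)
  have "compact (h ` cball 0 R)"
    by (intro compact_continuous_image continuous_on_subset[OF c]) auto
  then obtain M where M: "\<And>x. x \<in> cball 0 R \<Longrightarrow> norm (h x) \<le> M"
    by (meson bounded_iff compact_imp_bounded imageI)
  have "norm (h x) \<le> max M 0" for x
    using M[of x] R[of x] by (cases "norm x \<le> R") (auto simp: le_max_iff_disj)
  then show thesis by (intro that[of "max M 0"]) auto
qed

lemma Cc_borel:
  fixes h :: "'a::euclidean_space \<Rightarrow> complex"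
  assumes "h \<in> Cc_space"
  shows "h \<in> borel_measurable borel"
  using assms by (simp add: Cc_space_def borel_measurable_continuous_onI)

lemma Cc_integrable:
  fixes h :: "'a::euclidean_space \<Rightarrow> complex"
  assumes "h \<in> Cc_space"
  shows "integrable lborel h"
proof -
  obtain R where c: "continuous_on UNIV h" and R: "\<And>x. R < norm x \<Longrightarrow> h x = 0"
    using assms by (auto simp: Cc_space_def)
  have "integrable lborel (\<lambda>x. indicator (cball 0 R) x *\<^sub>R h x)"
    by (intro borel_integrable_compact continuous_on_subset[OF c]) auto
  also have "(\<lambda>x. indicator (cball 0 R) x *\<^sub>R h x) = h"
    using R by (auto simp: fun_eq_iff indicator_def not_le)
  finally show ?thesis .
qed

lemma Cc_mult:
  assumes "continuous_on UNIV c" "h \<in> Cc_space"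
  shows "(\<lambda>x. c x * h x) \<in> Cc_space"
  using assms by (auto simp: Cc_space_def intro!: continuous_intros)

lemma Cc_add:
  assumes "f \<in> Cc_space" "h \<in> Cc_space"
  shows "(\<lambda>x. f x + h x) \<in> Cc_space"
proof -
  obtain R S where "\<And>x. R < norm x \<Longrightarrow> f x = 0" "\<And>x. S < norm x \<Longrightarrow> h x = 0"
    using assms by (auto simp: Cc_space_def)
  then have "\<forall>x. max R S < norm x \<longrightarrow> f x + h x = 0" by auto
  then have "\<exists>R. \<forall>x. R < norm x \<longrightarrow> f x + h x = 0" by blast
  then show ?thesis using assms by (simp add: Cc_space_def continuous_on_add)
qed

lemma Cc_cnj: "h \<in> Cc_space \<Longrightarrow> (\<lambda>x. cnj (h x)) \<in> Cc_space"
  by (auto simp: Cc_space_def intro!: continuous_intros)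

section \<open>The Plancherel identity for continuous functions of compact support\<close>

definition normal_density_vec :: "real^'n::finite \<Rightarrow> real" where
  "normal_density_vec u = (\<Prod>k\<in>UNIV. std_normal_density (u $ k))"

lemma normal_density_vec_integral:
  "integrable lborel (\<lambda>u::real^'n::finite. complex_of_real (normal_density_vec u))"
  "(LINT u|lborel. complex_of_real (normal_density_vec (u::real^'n::finite))) = 1"
  "integrable lborel (\<lambda>u::real^'n::finite. normal_density_vec u)"
  "(LINT u|lborel. normal_density_vec (u::real^'n::finite)) = 1"
proof -
  show i: "integrable lborel (\<lambda>u::real^'n::finite. normal_density_vec u)"
    unfolding normal_density_vec_def by (rule lborel_vec_integral_prod(1)) simp
  show e: "(LINT u|lborel. normal_density_vec (u::real^'n::finite)) = 1"
    unfolding normal_density_vec_def by (subst lborel_vec_integral_prod(2)) auto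
  show "integrable lborel (\<lambda>u::real^'n::finite. complex_of_real (normal_density_vec u))"
    using i by (rule integrable_of_real)
  show "(LINT u|lborel. complex_of_real (normal_density_vec (u::real^'n::finite))) = 1"
    using e by simp
qed

lemma normal_density_vec_nonneg: "normal_density_vec u \<ge> 0"
  by (simp add: normal_density_vec_def prod_nonneg normal_density_nonneg)

text \<open>
  The inner integral is a Gaussian in \<open>x - y\<close> of width \<open>1 / (b\<^sub>k s)\<close> in direction \<open>k\<close>. Substituting
  \<open>y\<^sub>k = x\<^sub>k + u\<^sub>k / (b\<^sub>k s)\<close> makes it the fixed density of \<open>u\<close> and leaves the constant free of \<open>s\<close>.
\<close>

lemma gaussian_window_convolution:
  fixes b :: "'n::finite \<Rightarrow> real"
  assumes s: "s > 0" and b: "\<And>k. b k \<noteq> 0" and h: "h \<in> Cc_space"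
  shows "(LINT y|lborel. h y * (LINT w|lborel. plane_wave b (x - y) w * of_real (gaussian_window s w))) =
    of_real (\<Prod>k\<in>UNIV. 2 * pi / \<bar>b k\<bar>) *
      (LINT u|lborel. h (x + (\<chi> k. 1 / (b k * s) * u $ k)) * of_real (normal_density_vec u))"
proof -
  note [measurable] = Cc_borel[OF h]
  have [measurable]: "(\<lambda>y::real^'n. y $ k) \<in> borel_measurable borel" for k
    by (intro borel_measurable_continuous_onI continuous_intros)
  have K: "(LINT w|lborel. plane_wave b z w * of_real (gaussian_window s w)) =
    of_real (\<Prod>k\<in>UNIV. 2 * pi * s * std_normal_density (b k * z $ k * s))" for z
    by (rule gaussian_window_fourier[OF s])
  have "(LINT y|lborel. h y * of_real (\<Prod>k\<in>UNIV. 2 * pi * s * std_normal_density (b k * (x - y) $ k * s))) =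
    (\<Prod>k\<in>UNIV. \<bar>1 / (b k * s)\<bar>) *\<^sub>R (LINT u|lborel. h (x + (\<chi> k. 1 / (b k * s) * u $ k)) *
      of_real (\<Prod>k\<in>UNIV. 2 * pi * s * std_normal_density (b k * (x - (x + (\<chi> k. 1 / (b k * s) * u $ k))) $ k * s)))"
    by (rule lborel_integral_diagonal) (use s b in \<open>auto simp del: vector_minus_component\<close>)
  also have "\<dots> = (\<Prod>k\<in>UNIV. \<bar>1 / (b k * s)\<bar>) *\<^sub>R (LINT u|lborel. h (x + (\<chi> k. 1 / (b k * s) * u $ k)) *
      of_real ((\<Prod>k\<in>(UNIV::'n set). 2 * pi * s) * normal_density_vec u))"
  proof -
    have "(\<Prod>k\<in>UNIV. 2 * pi * s * std_normal_density (b k * (x - (x + (\<chi> k. 1 / (b k * s) * u $ k))) $ k * s)) =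
        (\<Prod>k\<in>(UNIV::'n set). 2 * pi * s) * normal_density_vec u" for u
      unfolding normal_density_vec_def prod.distrib[symmetric]
      using s b by (intro prod.cong) (auto simp: std_normal_density_def)
    then show ?thesis by (simp only:)
  qed
  also have "\<dots> = of_real ((\<Prod>k\<in>UNIV. \<bar>1 / (b k * s)\<bar>) * (\<Prod>k\<in>(UNIV::'n set). 2 * pi * s)) *
     (LINT u|lborel. h (x + (\<chi> k. 1 / (b k * s) * u $ k)) * of_real (normal_density_vec u))"
    by (simp only: scaleR_conv_of_real of_real_mult mult.assoc flip: integral_mult_right_zero)
       (simp only: mult_ac)
  also have "(\<Prod>k\<in>UNIV. \<bar>1 / (b k * s)\<bar>) * (\<Prod>k\<in>(UNIV::'n set). 2 * pi * s) =
      (\<Prod>k\<in>UNIV. 2 * pi / \<bar>b k\<bar>)"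
    unfolding prod.distrib[symmetric] using s by (intro prod.cong) (auto simp: abs_mult field_simps)
  finally show ?thesis by (simp only: K)
qed

lemma plane_wave_transform_measurable:
  fixes b :: "'n::finite \<Rightarrow> real"
  assumes [measurable]: "h \<in> borel_measurable borel"
  shows "(\<lambda>w. LINT x|lborel. plane_wave b x w * h x) \<in> borel_measurable borel"
proof -
  have [measurable]: "(\<lambda>p. plane_wave b (fst p) (snd p)) \<in> borel_measurable (borel \<Otimes>\<^sub>M borel)"
    using plane_wave_measurable[of b] by (simp cong: measurable_cong_sets)
  have "(\<lambda>(w, x). plane_wave b x w * h x) \<in> borel_measurable (borel \<Otimes>\<^sub>M lborel)"
  proof -
    have "(\<lambda>p. plane_wave b (fst (snd p, fst p)) (snd (snd p, fst p)) * h (snd p)) \<in> borel_measurable (borel \<Otimes>\<^sub>M borel)"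
      by (intro borel_measurable_times measurable_compose[OF _ plane_wave_measurable[of b]]) measurable
    then show ?thesis by (simp add: case_prod_beta cong: measurable_cong_sets)
  qed
  then show ?thesis
    by (rule lborel.borel_measurable_lebesgue_integral)
qed

lemma mult_cnj_norm: "z * cnj z = of_real ((norm z)\<^sup>2)"
  by (metis complex_norm_square)

text \<open>
  Expanding \<open>\<bar>F\<bar>\<^sup>2 = F cnj F\<close> and applying the multiplication formula to each factor leaves the
  Fourier integral of the Gaussian window alone.
\<close>

lemma regularised_plancherel:
  fixes b :: "'n::finite \<Rightarrow> real"
  assumes s: "s > 0" and b: "\<And>k. b k \<noteq> 0" and h: "h \<in> Cc_space"
  defines "F \<equiv> \<lambda>w. LINT x|lborel. plane_wave b x w * h x"
  shows "integrable lborel (\<lambda>w. (norm (F w))\<^sup>2 * gaussian_window s w)"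
    and "of_real (LINT w|lborel. (norm (F w))\<^sup>2 * gaussian_window s w) =
      of_real (\<Prod>k\<in>UNIV. 2 * pi / \<bar>b k\<bar>) * (LINT x|lborel. h x *
        (LINT u|lborel. cnj (h (x + (\<chi> k. 1 / (b k * s) * u $ k))) * of_real (normal_density_vec u)))"
proof -
  note [measurable] = Cc_borel[OF h]
  have [measurable]: "F \<in> borel_measurable borel"
    unfolding F_def by (rule plane_wave_transform_measurable) simp
  note G = gaussian_window_integrable[OF s, where 'n='n]
  have Fb: "norm (F w) \<le> (LINT x|lborel. norm (h x))" for w
    unfolding F_def by (rule order_trans[OF integral_norm_bound]) (simp add: norm_mult)
  define A where "A = (LINT x|lborel. norm (h x))"
  have A: "A \<ge> 0" by (simp add: A_def)
  \<comment> \<open>\<open>F\<close> is bounded by the \<open>L\<^sup>1\<close>-norm of \<open>h\<close>; the window supplies the decay.\<close>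
  have FG: "integrable lborel (\<lambda>w. cnj (F w) * of_real (gaussian_window s w))"
  proof (rule Bochner_Integration.integrable_bound)
    show "integrable lborel (\<lambda>w::real^'n. of_real A * complex_of_real (gaussian_window s w))"
      by (rule integrable_mult_right) (rule G)
    show "AE w in lborel. norm (cnj (F w) * of_real (gaussian_window s w)) \<le> norm (of_real A * complex_of_real (gaussian_window s w))"
      using Fb A by (auto simp: norm_mult A_def intro!: mult_right_mono)
  qed measurable
  have FFG: "integrable lborel (\<lambda>w. F w * (cnj (F w) * of_real (gaussian_window s w)))"
  proof (rule Bochner_Integration.integrable_bound)
    show "integrable lborel (\<lambda>w. of_real A * (cnj (F w) * of_real (gaussian_window s w)))"
      by (rule integrable_mult_right) (rule FG)
    show "AE w in lborel. norm (F w * (cnj (F w) * of_real (gaussian_window s w))) \<le>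
        norm (of_real A * (cnj (F w) * of_real (gaussian_window s w)))"
      using Fb A by (auto simp: norm_mult A_def intro!: mult_right_mono)
  qed measurable
  have eq: "F w * (cnj (F w) * of_real (gaussian_window s w)) = complex_of_real ((norm (F w))\<^sup>2 * gaussian_window s w)" for w
    by (simp only: mult.assoc[symmetric] mult_cnj_norm of_real_mult)
  show "integrable lborel (\<lambda>w. (norm (F w))\<^sup>2 * gaussian_window s w)"
    using FFG unfolding eq by (simp only: complex_of_real_integrable_eq)
  have m1: "(\<lambda>(x, w). plane_wave b x w) \<in> borel_measurable (lborel \<Otimes>\<^sub>M lborel)"
    using plane_wave_measurable[of b] by (simp add: case_prod_beta)
  then have m2: "(\<lambda>(x, w). cnj (plane_wave b x w)) \<in> borel_measurable (lborel \<Otimes>\<^sub>M lborel)"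
    by (simp add: case_prod_beta)
  have vG: "integrable lborel (\<lambda>w. plane_wave b x w * of_real (gaussian_window s w))" for x
  proof (rule Bochner_Integration.integrable_bound[OF G])
    have "continuous_on UNIV (\<lambda>w::real^'n. plane_wave b x w)"
      unfolding plane_wave_def by (intro continuous_intros)
    then have [measurable]: "(\<lambda>w. plane_wave b x w) \<in> borel_measurable borel"
      by (rule borel_measurable_continuous_onI)
    show "(\<lambda>w. plane_wave b x w * of_real (gaussian_window s w)) \<in> borel_measurable lborel" by measurable
  qed (simp add: norm_mult)
  have "complex_of_real (LINT w|lborel. (norm (F w))\<^sup>2 * gaussian_window s w) =
      (LINT w|lborel. F w * (cnj (F w) * of_real (gaussian_window s w)))"
    by (simp only: eq integral_complex_of_real)
  also have "\<dots> = (LINT x|lborel. h x * (LINT w|lborel. plane_wave b x w * (cnj (F w) * of_real (gaussian_window s w))))"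
    unfolding F_def by (rule multiplication_formula[OF m1 _ Cc_integrable[OF h] FG[unfolded F_def]]) simp
  also have "\<dots> = (LINT x|lborel. h x * (of_real (\<Prod>k\<in>UNIV. 2 * pi / \<bar>b k\<bar>) *
      (LINT u|lborel. cnj (h (x + (\<chi> k. 1 / (b k * s) * u $ k))) * of_real (normal_density_vec u))))"
  proof -
    have "(LINT w|lborel. plane_wave b x w * (cnj (F w) * of_real (gaussian_window s w))) =
      of_real (\<Prod>k\<in>UNIV. 2 * pi / \<bar>b k\<bar>) *
      (LINT u|lborel. cnj (h (x + (\<chi> k. 1 / (b k * s) * u $ k))) * of_real (normal_density_vec u))" for x
    proof -
      have "(LINT w|lborel. plane_wave b x w * (cnj (F w) * of_real (gaussian_window s w))) =
        (LINT w|lborel. (LINT y|lborel. cnj (plane_wave b y w) * cnj (h y)) * (plane_wave b x w * of_real (gaussian_window s w)))"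
      proof -
        have "cnj (F w) = (LINT y|lborel. cnj (plane_wave b y w) * cnj (h y))" for w
          unfolding F_def by (simp flip: integral_cnj complex_cnj_mult)
        then show ?thesis by (simp only: mult.left_commute)
      qed
      also have "\<dots> = (LINT y|lborel. cnj (h y) * (LINT w|lborel. cnj (plane_wave b y w) * (plane_wave b x w * of_real (gaussian_window s w))))"
        by (rule multiplication_formula[OF m2 _ Cc_integrable[OF Cc_cnj[OF h]] vG]) simp
      also have "\<dots> = (LINT y|lborel. cnj (h y) * (LINT w|lborel. plane_wave b (x - y) w * of_real (gaussian_window s w)))"
        by (simp add: mult_ac flip: plane_wave_diff)
      also have "\<dots> = of_real (\<Prod>k\<in>UNIV. 2 * pi / \<bar>b k\<bar>) *
         (LINT u|lborel. cnj (h (x + (\<chi> k. 1 / (b k * s) * u $ k))) * of_real (normal_density_vec u))"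
        by (rule gaussian_window_convolution[OF s b Cc_cnj[OF h]])
      finally show ?thesis .
    qed
    then show ?thesis by (simp only:)
  qed
  also have "\<dots> = of_real (\<Prod>k\<in>UNIV. 2 * pi / \<bar>b k\<bar>) * (LINT x|lborel. h x *
        (LINT u|lborel. cnj (h (x + (\<chi> k. 1 / (b k * s) * u $ k))) * of_real (normal_density_vec u)))"
    by (simp only: mult.left_commute flip: integral_mult_right_zero)
  finally show "of_real (LINT w|lborel. (norm (F w))\<^sup>2 * gaussian_window s w) =
      of_real (\<Prod>k\<in>UNIV. 2 * pi / \<bar>b k\<bar>) * (LINT x|lborel. h x *
        (LINT u|lborel. cnj (h (x + (\<chi> k. 1 / (b k * s) * u $ k))) * of_real (normal_density_vec u)))" .
qed

text \<open>
  The shifted arguments tend to \<open>x\<close>, and the boundedness of \<open>g\<close> gives integrable majorants for the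
  inner and for the outer integral.
\<close>

lemma normal_density_approximate_identity:
  fixes b :: "'n::finite \<Rightarrow> real"
  assumes h: "h \<in> Cc_space" and g: "g \<in> Cc_space"
  shows "(\<lambda>n. LINT x|lborel. h x *
      (LINT u|lborel. g (x + (\<chi> k. 1 / (b k * real (Suc n)) * u $ k)) * of_real (normal_density_vec u)))
    \<longlonglongrightarrow> (LINT x|lborel. h x * g x)"
proof -
  note [measurable] = Cc_borel[OF h] Cc_borel[OF g]
  have nm [measurable]: "(\<lambda>u::real^'n. complex_of_real (normal_density_vec u)) \<in> borel_measurable borel"
    using normal_density_vec_integral(1)[where 'n='n] by auto
  have [measurable]: "(\<lambda>y::real^'n. y $ k) \<in> borel_measurable borel" for k
    by (intro borel_measurable_continuous_onI continuous_intros)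
  obtain M where M: "M \<ge> 0" "\<And>x. norm (g x) \<le> M" using Cc_bounded[OF g] by blast
  define S where "S n u = (\<chi> k. 1 / (b k * real (Suc n)) * u $ k)" for n and u :: "real^'n"
  have S0: "(\<lambda>n. S n u) \<longlonglongrightarrow> 0" for u
  proof (rule vec_tendstoI)
    fix k
    have "(\<lambda>n. 1 / b k * u $ k * inverse (real (Suc n))) \<longlonglongrightarrow> 1 / b k * u $ k * 0"
      by (intro tendsto_intros LIMSEQ_inverse_real_of_nat)
    then show "(\<lambda>n. S n u $ k) \<longlonglongrightarrow> 0 $ k"
      by (simp add: S_def field_simps)
  qed
  have Sc: "continuous_on UNIV (S n)" for n
    unfolding S_def by (intro continuous_intros)
  then have [measurable]: "S n \<in> borel_measurable borel" for n
    by (rule borel_measurable_continuous_onI)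
  have gc: "isCont g x" for x
    using g by (auto simp: Cc_space_def continuous_on_eq_continuous_at)
  define J where "J n x = (LINT u|lborel. g (x + S n u) * of_real (normal_density_vec u))" for n x
  have bd: "norm (g (x + S n u) * of_real (normal_density_vec u)) \<le> M * normal_density_vec u" for x n u
    using M normal_density_vec_nonneg[of u] by (auto simp: norm_mult intro!: mult_right_mono)
  have J: "(\<lambda>n. J n x) \<longlonglongrightarrow> (LINT u|lborel. g x * of_real (normal_density_vec (u::real^'n)))" for x
    unfolding J_def
  proof (rule integral_dominated_convergence[where w="\<lambda>u::real^'n. M * normal_density_vec u"])
    show "AE u in lborel. (\<lambda>n. g (x + S n u) * of_real (normal_density_vec u)) \<longlonglongrightarrow> g x * of_real (normal_density_vec u)"
    proof (rule AE_I2)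
      fix u
      have "(\<lambda>n. x + S n u) \<longlonglongrightarrow> x + 0" by (intro tendsto_intros S0)
      then have "(\<lambda>n. g (x + S n u)) \<longlonglongrightarrow> g x"
        by (intro isCont_tendsto_compose[OF gc]) simp
      then show "(\<lambda>n. g (x + S n u) * of_real (normal_density_vec u)) \<longlonglongrightarrow> g x * of_real (normal_density_vec u)"
        by (intro tendsto_intros)
    qed
  qed (use bd normal_density_vec_integral(3) in \<open>auto\<close>)
  have Jm [measurable]: "J n \<in> borel_measurable borel" for n
    unfolding J_def by measurable
  have Jb: "norm (J n x) \<le> M" for n x
  proof -
    have "norm (J n x) \<le> (LINT u|lborel. M * normal_density_vec (u::real^'n))"
      unfolding J_def
    proof (rule order_trans[OF integral_norm_bound integral_mono'])
      show "integrable lborel (\<lambda>u::real^'n. M * normal_density_vec u)"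
        by (rule integrable_mult_right) (rule normal_density_vec_integral)
      show "0 \<le> M * normal_density_vec u" for u :: "real^'n"
        by (rule mult_nonneg_nonneg[OF M(1) normal_density_vec_nonneg])
    qed (rule bd)
    then show ?thesis by (simp add: normal_density_vec_integral)
  qed
  have "(\<lambda>n. LINT x|lborel. h x * J n x) \<longlonglongrightarrow> (LINT x|lborel. h x * g x)"
  proof (rule integral_dominated_convergence[where w="\<lambda>x. M * norm (h x)"])
    show "AE x in lborel. (\<lambda>n. h x * J n x) \<longlonglongrightarrow> h x * g x"
      using J by (auto intro!: tendsto_intros simp: normal_density_vec_integral)
    show "AE x in lborel. norm (h x * J n x) \<le> M * norm (h x)" for n
      unfolding norm_mult mult.commute[of M] using Jb by (intro AE_I2 mult_left_mono) auto
  qed (use Cc_integrable[OF h] in auto)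
  then show ?thesis by (simp add: J_def S_def)
qed

lemma gaussian_window_increasing: "mono (\<lambda>n. gaussian_window (real (Suc n)) w)"
proof (rule monoI)
  fix m n :: nat assume mn: "m \<le> n"
  show "gaussian_window (real (Suc m)) w \<le> gaussian_window (real (Suc n)) w"
    unfolding gaussian_window_def
  proof (intro prod_mono conjI)
    fix k
    have "\<bar>w $ k\<bar> / real (Suc n) \<le> \<bar>w $ k\<bar> / real (Suc m)"
      using mn by (intro divide_left_mono) auto
    then have "(\<bar>w $ k\<bar> / real (Suc n))\<^sup>2 \<le> (\<bar>w $ k\<bar> / real (Suc m))\<^sup>2"
      by (intro power_mono) auto
    then show "exp (- (w $ k / real (Suc m))\<^sup>2 / 2) \<le> exp (- (w $ k / real (Suc n))\<^sup>2 / 2)"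
      by (simp add: power_divide)
  qed simp
qed

lemma gaussian_window_tendsto_1: "(\<lambda>n. gaussian_window (real (Suc n)) w) \<longlonglongrightarrow> 1"
proof -
  have "(\<lambda>n. w $ k * inverse (real (Suc n))) \<longlonglongrightarrow> w $ k * 0" for k
    by (intro tendsto_intros LIMSEQ_inverse_real_of_nat)
  then have *: "(\<lambda>n. w $ k / (real (Suc n))) \<longlonglongrightarrow> 0" for k
    by (simp add: divide_inverse)
  have "(\<lambda>n. gaussian_window (real (Suc n)) w) \<longlonglongrightarrow> (\<Prod>k\<in>(UNIV::'a set). exp (- (0)\<^sup>2 / 2))"
    unfolding gaussian_window_def by (intro tendsto_intros *) auto
  then show ?thesis by simp
qed

text \<open>
  Let the width of the Gaussian window tend to infinity in \<open>regularised_plancherel\<close>.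
\<close>

lemma plancherel_Cc:
  fixes b :: "'n::finite \<Rightarrow> real"
  assumes b: "\<And>k. b k \<noteq> 0" and h: "h \<in> Cc_space"
  defines "F \<equiv> \<lambda>w. LINT x|lborel. plane_wave b x w * h x"
  shows "integrable lborel (\<lambda>w. (norm (F w))\<^sup>2)"
    and "(LINT w|lborel. (norm (F w))\<^sup>2) =
      (\<Prod>k\<in>UNIV. 2 * pi / \<bar>b k\<bar>) * (LINT x|lborel. (norm (h x))\<^sup>2)"
proof -
  note [measurable] = Cc_borel[OF h]
  have Fm [measurable]: "F \<in> borel_measurable borel"
    unfolding F_def by (rule plane_wave_transform_measurable) simp
  \<comment> \<open>The widths are \<open>Suc n\<close> because a width has to be positive.\<close>
  define f where "f n w = (norm (F w))\<^sup>2 * gaussian_window (real (Suc n)) w" for n w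
  have f: "integrable lborel (f n)" for n
    unfolding f_def F_def by (rule regularised_plancherel(1)) (use b h in auto)
  have hh: "(LINT x|lborel. h x * cnj (h x)) = of_real (LINT x|lborel. (norm (h x))\<^sup>2)"
    by (simp only: mult_cnj_norm integral_complex_of_real)
  have "(\<lambda>n. complex_of_real (LINT w|lborel. f n w)) \<longlonglongrightarrow>
      of_real (\<Prod>k\<in>UNIV. 2 * pi / \<bar>b k\<bar>) * (LINT x|lborel. h x * cnj (h x))"
  proof -
    have "complex_of_real (LINT w|lborel. f n w) =
      of_real (\<Prod>k\<in>UNIV. 2 * pi / \<bar>b k\<bar>) * (LINT x|lborel. h x *
        (LINT u|lborel. cnj (h (x + (\<chi> k. 1 / (b k * real (Suc n)) * u $ k))) * of_real (normal_density_vec u)))" for n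
      unfolding f_def F_def by (rule regularised_plancherel(2)) (use b h in auto)
    then show ?thesis
      by (simp only:) (intro tendsto_intros normal_density_approximate_identity[OF h Cc_cnj[OF h], of b])
  qed
  then have lim: "(\<lambda>n. LINT w|lborel. f n w) \<longlonglongrightarrow>
      (\<Prod>k\<in>UNIV. 2 * pi / \<bar>b k\<bar>) * (LINT x|lborel. (norm (h x))\<^sup>2)"
    unfolding hh of_real_mult[symmetric] by (simp only: tendsto_of_real_iff)
  have mono: "AE w in lborel. mono (\<lambda>n. f n w)"
  proof (rule AE_I2)
    fix w
    show "mono (\<lambda>n. f n w)"
      unfolding f_def mono_def
      by (intro allI impI mult_left_mono monoD[OF gaussian_window_increasing]) auto
  qed
  have conv: "AE w in lborel. (\<lambda>n. f n w) \<longlonglongrightarrow> (norm (F w))\<^sup>2"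
  proof (rule AE_I2)
    fix w
    have "(\<lambda>n. f n w) \<longlonglongrightarrow> (norm (F w))\<^sup>2 * 1"
      unfolding f_def by (intro tendsto_intros gaussian_window_tendsto_1)
    then show "(\<lambda>n. f n w) \<longlonglongrightarrow> (norm (F w))\<^sup>2" by simp
  qed
  have m: "(\<lambda>w. (norm (F w))\<^sup>2) \<in> borel_measurable lborel" by measurable
  show "integrable lborel (\<lambda>w. (norm (F w))\<^sup>2)"
    by (rule integrable_monotone_convergence[OF f mono conv lim m])
  show "(LINT w|lborel. (norm (F w))\<^sup>2) =
      (\<Prod>k\<in>UNIV. 2 * pi / \<bar>b k\<bar>) * (LINT x|lborel. (norm (h x))\<^sup>2)"
    by (rule integral_monotone_convergence[OF f mono conv lim m])
qed

section \<open>Density of the continuous functions of compact support\<close>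

lemma Cc_integrable_lebesgue:
  fixes f :: "real^'n::finite \<Rightarrow> complex"
  assumes "f \<in> Cc_space"
  shows "integrable lebesgue f"
  by (subst integrable_completion) (use Cc_borel[OF assms] Cc_integrable[OF assms] in auto)

lemma Cc_continuous: "f \<in> Cc_space \<Longrightarrow> continuous_on UNIV f"
  by (simp add: Cc_space_def)

lemma Cc_L2:
  fixes f :: "real^'n::finite \<Rightarrow> complex"
  assumes f: "f \<in> Cc_space"
  shows "f \<in> L2_space"
proof -
  have "(\<lambda>x. cnj (f x) * f x) \<in> Cc_space"
    using Cc_mult[OF Cc_continuous[OF Cc_cnj[OF f]] f] by simp
  then have "integrable lebesgue (\<lambda>x. norm (cnj (f x) * f x))"
    by (intro integrable_norm Cc_integrable_lebesgue)
  then show ?thesis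
    using measurable_completion[of f lborel borel] Cc_borel[OF f]
    by (simp add: L2_space_def norm_mult power2_eq_square)
qed

text \<open>
  The radial retraction of the complex plane onto the disc of radius \<open>M\<close>.
\<close>

definition clip :: "real \<Rightarrow> complex \<Rightarrow> complex" where
  "clip M z = of_real (M / max M (norm z)) * z"

text \<open>
  A measurable function is almost everywhere a limit of continuous functions. Clipping the
  values of these to the disc of radius \<open>M\<close> and multiplying by a continuous cutoff gives functions of compact support with
  the same limit and a common bounded majorant of bounded support, so that dominated convergence
  applies in both norms.
\<close>

lemma bounded_support_Cc_approx:
  fixes f :: "real^'n::finite \<Rightarrow> complex"
  assumes f [measurable]: "f \<in> borel_measurable lebesgue"
    and M: "M > 0" "\<And>x. norm (f x) \<le> M" and R: "\<And>x. R < norm x \<Longrightarrow> f x = 0"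
  obtains g where "\<And>n. g n \<in> Cc_space"
    "(\<lambda>n. L2_norm (\<lambda>x. g n x - f x)) \<longlonglongrightarrow> 0"
    "(\<lambda>n. LINT x|lebesgue. norm (g n x - f x)) \<longlonglongrightarrow> 0"
proof -
  have "f measurable_on UNIV"
    by (rule lebesgue_measurable_imp_measurable_on) auto
  then obtain N k where N: "negligible N" and k: "\<And>n. continuous_on UNIV (k n)"
    and lim: "\<And>x. x \<notin> N \<Longrightarrow> (\<lambda>n. k n x) \<longlonglongrightarrow> f x"
    unfolding measurable_on_def by auto
  define cut where "cut x = max 0 (min 1 (R + 1 - norm x))" for x :: "real^'n"
  have cut: "0 \<le> cut x" "cut x \<le> 1" "R + 1 < norm x \<Longrightarrow> cut x = 0" "norm x \<le> R \<Longrightarrow> cut x = 1" for x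
    by (auto simp: cut_def)
  have clip_cont: "continuous_on UNIV (clip M)"
    unfolding clip_def using M by (intro continuous_intros) auto
  have clip_le: "norm (clip M z) \<le> M" for z
    using M by (auto simp: clip_def norm_mult norm_divide max_def field_simps)
  have clip_id: "clip M z = z" if "norm z \<le> M" for z
    using M that by (simp add: clip_def max_def)
  have clip_0: "clip M 0 = 0" by (simp add: clip_def)
  define g where "g n x = of_real (cut x) * clip M (k n x)" for n x
  have gC: "g n \<in> Cc_space" for n
  proof -
    have "continuous_on UNIV (\<lambda>x. clip M (k n x))"
      by (rule continuous_on_compose2[OF clip_cont k]) auto
    then have "continuous_on UNIV (g n)"
      unfolding g_def cut_def by (intro continuous_intros)
    moreover have "\<forall>x. R + 1 < norm x \<longrightarrow> g n x = 0"
      by (simp add: g_def cut)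
    ultimately show ?thesis by (auto simp: Cc_space_def)
  qed
  have gM: "norm (g n x) \<le> M" for n x
  proof -
    have "cut x * norm (clip M (k n x)) \<le> 1 * M"
      using cut clip_le M by (intro mult_mono) auto
    then show ?thesis using cut by (simp add: g_def norm_mult)
  qed
  have g0: "g n x - f x = 0" if "R + 1 < norm x" for n x
    using that R[of x] by (simp add: g_def cut)
  have "AE x in lebesgue. x \<notin> N"
    using N by (intro AE_not_in) (simp add: negligible_iff_null_sets)
  then have conv: "AE x in lebesgue. (\<lambda>n. norm (g n x - f x)) \<longlonglongrightarrow> 0"
  proof eventually_elim
    case (elim x)
    have "isCont (clip M) (f x)"
      using clip_cont by (simp add: continuous_on_eq_continuous_at)
    then have "(\<lambda>n. clip M (k n x)) \<longlonglongrightarrow> clip M (f x)"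
      by (rule isCont_tendsto_compose) (rule lim[OF elim])
    then have "(\<lambda>n. g n x) \<longlonglongrightarrow> of_real (cut x) * clip M (f x)"
      unfolding g_def by (intro tendsto_intros)
    also have "of_real (cut x) * clip M (f x) = f x"
      using clip_id[OF M(2)] R[of x] cut(4)[of x] by (cases "norm x \<le> R") (auto simp: clip_0)
    finally show ?case by (simp add: LIM_zero_iff tendsto_norm_zero_iff)
  qed
  have [measurable]: "g n \<in> borel_measurable lebesgue" for n
    by (rule L2_measurable[OF Cc_L2[OF gC]])
  have dom: "norm (g n x - f x) \<le> 2 * M * indicator (cball 0 (R + 1)) x" for n x
  proof (cases "norm x \<le> R + 1")
    case True
    have "norm (g n x - f x) \<le> norm (g n x) + norm (f x)" by (rule norm_triangle_ineq4)
    then show ?thesis using gM[of n x] M(2)[of x] True by (simp add: indicator_def)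
  next
    case False
    then show ?thesis using g0[of x n] by (simp add: indicator_def)
  qed
  have ind: "integrable lebesgue (indicator (cball (0::real^'n) (R + 1)) :: _ \<Rightarrow> real)"
    by (subst integrable_completion)
       (auto intro!: borel_measurable_indicator integrable_real_indicator emeasure_bounded_finite)
  have 1: "(\<lambda>n. LINT x|lebesgue. norm (g n x - f x)) \<longlonglongrightarrow> (LINT x|(lebesgue :: (real^'n) measure). 0)"
  proof (rule integral_dominated_convergence)
    show "integrable lebesgue (\<lambda>x::real^'n. 2 * M * indicator (cball 0 (R + 1)) x)"
      by (rule integrable_mult_right) (rule ind)
    show "AE x in lebesgue. (\<lambda>n. norm (g n x - f x)) \<longlonglongrightarrow> 0" by (rule conv)
    show "AE x in lebesgue. norm (norm (g n x - f x)) \<le> 2 * M * indicator (cball 0 (R + 1)) x" for n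
      using dom by simp
  qed auto
  have "(\<lambda>n. LINT x|lebesgue. (norm (g n x - f x))\<^sup>2) \<longlonglongrightarrow> (LINT x|(lebesgue :: (real^'n) measure). 0)"
  proof (rule integral_dominated_convergence)
    show "integrable lebesgue (\<lambda>x::real^'n. (2 * M)\<^sup>2 * indicator (cball 0 (R + 1)) x)"
      by (rule integrable_mult_right) (rule ind)
    show "AE x in lebesgue. (\<lambda>n. (norm (g n x - f x))\<^sup>2) \<longlonglongrightarrow> 0"
      using conv
    proof eventually_elim
      case (elim x)
      have "(\<lambda>n. (norm (g n x - f x))\<^sup>2) \<longlonglongrightarrow> 0\<^sup>2" by (intro tendsto_intros elim)
      then show ?case by simp
    qed
    show "AE x in lebesgue. norm ((norm (g n x - f x))\<^sup>2) \<le> (2 * M)\<^sup>2 * indicator (cball 0 (R + 1)) x" for n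
    proof (rule AE_I2)
      fix x
      have "(norm (g n x - f x))\<^sup>2 \<le> (2 * M * indicator (cball 0 (R + 1)) x)\<^sup>2"
        by (rule power_mono[OF dom]) simp
      also have "\<dots> = (2 * M)\<^sup>2 * indicator (cball 0 (R + 1)) x"
        by (simp add: indicator_def)
      finally show "norm ((norm (g n x - f x))\<^sup>2) \<le> (2 * M)\<^sup>2 * indicator (cball 0 (R + 1)) x" by simp
    qed
  qed auto
  then have "(\<lambda>n. sqrt (LINT x|lebesgue. (norm (g n x - f x))\<^sup>2)) \<longlonglongrightarrow> sqrt 0"
    by (intro tendsto_intros) simp
  then show thesis
    using that[OF gC] 1 by (simp add: L2_norm_def)
qed

text \<open>
  Truncating the domain and the values keeps the functions below \<open>f\<close>, which is itself the majorant
  for dominated convergence.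
\<close>

lemma L2_truncation_approx:
  fixes f :: "real^'n::finite \<Rightarrow> complex"
  assumes f: "f \<in> L2_space"
  defines "t \<equiv> \<lambda>n x. if norm x \<le> real n \<and> norm (f x) \<le> real n then f x else 0"
  shows "t n \<in> L2_space"
    and "(\<lambda>n. L2_norm (\<lambda>x. t n x - f x)) \<longlonglongrightarrow> 0"
    and "integrable lebesgue f \<Longrightarrow> integrable lebesgue (t n)"
    and "integrable lebesgue f \<Longrightarrow> (\<lambda>n. LINT x|lebesgue. norm (t n x - f x)) \<longlonglongrightarrow> 0"
proof -
  note [measurable] = L2_measurable[OF f]
  have [measurable]: "(\<lambda>x::real^'n. norm x) \<in> borel_measurable lebesgue"
    by (intro measurable_completion) simp
  have [measurable]: "t n \<in> borel_measurable lebesgue" for n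
    unfolding t_def by measurable
  have le: "norm (t n x) \<le> norm (f x)" for n x by (simp add: t_def)
  have le2: "norm (t n x - f x) \<le> norm (f x)" for n x by (simp add: t_def)
  have ev: "\<forall>\<^sub>F n in sequentially. norm (t n x - f x) = 0" for x
    using eventually_ge_at_top[of "nat \<lceil>max (norm x) (norm (f x))\<rceil>"]
  proof eventually_elim
    case (elim n)
    then have "norm x \<le> real n" "norm (f x) \<le> real n" by linarith+
    then show ?case by (simp add: t_def)
  qed
  show "t n \<in> L2_space"
  proof -
    have "integrable lebesgue (\<lambda>x. (norm (t n x))\<^sup>2)"
    proof (rule Bochner_Integration.integrable_bound[OF L2_square_integrable[OF f]])
      show "AE x in lebesgue. norm ((norm (t n x))\<^sup>2) \<le> norm ((norm (f x))\<^sup>2)"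
        using power_mono[OF le, of _ _ 2] by auto
    qed measurable
    then show ?thesis by (simp add: L2_space_def)
  qed
  have "(\<lambda>n. LINT x|lebesgue. (norm (t n x - f x))\<^sup>2) \<longlonglongrightarrow> (LINT x|(lebesgue :: (real^'n) measure). 0)"
  proof (rule integral_dominated_convergence[OF _ _ L2_square_integrable[OF f]])
    show "AE x in lebesgue. (\<lambda>n. (norm (t n x - f x))\<^sup>2) \<longlonglongrightarrow> 0"
    proof (rule AE_I2)
      fix x
      show "(\<lambda>n. (norm (t n x - f x))\<^sup>2) \<longlonglongrightarrow> 0"
        by (rule tendsto_eventually) (use ev[of x] in \<open>auto elim: eventually_mono\<close>)
    qed
    show "AE x in lebesgue. norm ((norm (t n x - f x))\<^sup>2) \<le> (norm (f x))\<^sup>2" for n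
      using power_mono[OF le2, of _ _ 2] by auto
  qed auto
  then have "(\<lambda>n. sqrt (LINT x|lebesgue. (norm (t n x - f x))\<^sup>2)) \<longlonglongrightarrow> sqrt 0"
    by (intro tendsto_intros) simp
  then show "(\<lambda>n. L2_norm (\<lambda>x. t n x - f x)) \<longlonglongrightarrow> 0" by (simp add: L2_norm_def)
  assume i: "integrable lebesgue f"
  show "integrable lebesgue (t n)"
    by (rule Bochner_Integration.integrable_bound[OF i]) (use le in auto)
  have "(\<lambda>n. LINT x|lebesgue. norm (t n x - f x)) \<longlonglongrightarrow> (LINT x|(lebesgue :: (real^'n) measure). 0)"
  proof (rule integral_dominated_convergence[OF _ _ integrable_norm[OF i]])
    show "AE x in lebesgue. (\<lambda>n. norm (t n x - f x)) \<longlonglongrightarrow> 0"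
      using tendsto_eventually[OF ev] by auto
    show "AE x in lebesgue. norm (norm (t n x - f x)) \<le> norm (f x)" for n
      using le2 by auto
  qed auto
  then show "(\<lambda>n. LINT x|lebesgue. norm (t n x - f x)) \<longlonglongrightarrow> 0" by simp
qed

text \<open>
  For integrable \<open>f\<close> one and the same sequence converges in \<open>L\<^sup>1\<close> and in \<open>L\<^sup>2\<close>. This is what identifies
  the \<open>L\<^sup>2\<close>-limit of the transforms with the integral transform of \<open>f\<close>.
\<close>

lemma Cc_dense:
  fixes f :: "real^'n::finite \<Rightarrow> complex"
  assumes f: "f \<in> L2_space"
  obtains g where "\<And>n. g n \<in> Cc_space"
    "(\<lambda>n. L2_norm (\<lambda>x. g n x - f x)) \<longlonglongrightarrow> 0"
    "integrable lebesgue f \<Longrightarrow> (\<lambda>n. LINT x|lebesgue. norm (g n x - f x)) \<longlonglongrightarrow> 0"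
proof -
  \<comment> \<open>Truncate first, with an error of half of \<open>e\<close>, then approximate the truncated function.\<close>
  define t where "t n x = (if norm x \<le> real n \<and> norm (f x) \<le> real n then f x else 0)" for n x
  note T = L2_truncation_approx[OF f, folded t_def]
  have "\<exists>g. g \<in> Cc_space \<and> L2_norm (\<lambda>x. g x - f x) < e \<and>
      (integrable lebesgue f \<longrightarrow> (LINT x|lebesgue. norm (g x - f x)) < e)" if e: "e > 0" for e
  proof -
    have "\<forall>\<^sub>F n in sequentially. L2_norm (\<lambda>x. t n x - f x) < e / 2"
      using e by (intro order_tendstoD(2)[OF T(2)]) simp
    moreover have "\<forall>\<^sub>F n in sequentially. integrable lebesgue f \<longrightarrow> (LINT x|lebesgue. norm (t n x - f x)) < e / 2"
      using order_tendstoD(2)[OF T(4), of "e / 2"] e by (cases "integrable lebesgue f") auto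
    ultimately have "\<forall>\<^sub>F n in sequentially. L2_norm (\<lambda>x. t n x - f x) < e / 2 \<and>
        (integrable lebesgue f \<longrightarrow> (LINT x|lebesgue. norm (t n x - f x)) < e / 2)"
      by eventually_elim auto
    then obtain n where n: "L2_norm (\<lambda>x. t n x - f x) < e / 2"
        "integrable lebesgue f \<Longrightarrow> (LINT x|lebesgue. norm (t n x - f x)) < e / 2"
      by (auto simp: eventually_sequentially)
    obtain g where g: "\<And>m. g m \<in> Cc_space"
      "(\<lambda>m. L2_norm (\<lambda>x. g m x - t n x)) \<longlonglongrightarrow> 0"
      "(\<lambda>m. LINT x|lebesgue. norm (g m x - t n x)) \<longlonglongrightarrow> 0"
    proof (rule bounded_support_Cc_approx[of "t n" "real n + 1" "real n"])
      show "t n \<in> borel_measurable lebesgue" by (rule L2_measurable[OF T(1)])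
      show "norm (t n x) \<le> real n + 1" for x by (simp add: t_def)
    qed (auto simp: t_def)
    have "\<forall>\<^sub>F m in sequentially. L2_norm (\<lambda>x. g m x - t n x) < e / 2 \<and>
        (LINT x|lebesgue. norm (g m x - t n x)) < e / 2"
      using e by (intro eventually_conj order_tendstoD(2)[OF g(2)] order_tendstoD(2)[OF g(3)]) auto
    then obtain m where m: "L2_norm (\<lambda>x. g m x - t n x) < e / 2"
        "(LINT x|lebesgue. norm (g m x - t n x)) < e / 2"
      by (auto simp: eventually_sequentially)
    have "L2_norm (\<lambda>x. g m x - f x) < e"
      using L2_triangle_sub[OF Cc_L2[OF g(1)] T(1) f, of m n] m n by simp
    moreover have "(LINT x|lebesgue. norm (g m x - f x)) < e" if i: "integrable lebesgue f"
    proof -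
      note gi = Cc_integrable_lebesgue[OF g(1), of m]
      have "(LINT x|lebesgue. norm (g m x - f x)) \<le>
          (LINT x|lebesgue. norm (g m x - t n x) + norm (t n x - f x))"
        using gi i T(3)[OF i, of n]
        by (intro integral_mono Bochner_Integration.integrable_add integrable_norm Bochner_Integration.integrable_diff)
           (auto intro: norm_diff_triangle_le)
      also have "\<dots> = (LINT x|lebesgue. norm (g m x - t n x)) + (LINT x|lebesgue. norm (t n x - f x))"
        using gi i T(3)[OF i, of n] by (intro Bochner_Integration.integral_add) auto
      finally show ?thesis using m(2) n(2)[OF i] by simp
    qed
    ultimately show ?thesis using g(1) by blast
  qed
  then have "\<forall>n. \<exists>g. g \<in> Cc_space \<and> L2_norm (\<lambda>x. g x - f x) < inverse (real (Suc n)) \<and>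
      (integrable lebesgue f \<longrightarrow> (LINT x|lebesgue. norm (g x - f x)) < inverse (real (Suc n)))"
    by simp
  then obtain g where g: "\<And>n. g n \<in> Cc_space"
      "\<And>n. L2_norm (\<lambda>x. g n x - f x) < inverse (real (Suc n))"
      "\<And>n. integrable lebesgue f \<Longrightarrow> (LINT x|lebesgue. norm (g n x - f x)) < inverse (real (Suc n))"
    by metis
  show thesis
  proof (rule that[OF g(1)])
    show "(\<lambda>n. L2_norm (\<lambda>x. g n x - f x)) \<longlonglongrightarrow> 0"
      by (rule Lim_null_comparison[OF _ LIMSEQ_inverse_real_of_nat])
         (use g(2) in \<open>auto simp: L2_norm_nonneg less_imp_le simp del: of_nat_Suc\<close>)
    assume i: "integrable lebesgue f"
    show "(\<lambda>n. LINT x|lebesgue. norm (g n x - f x)) \<longlonglongrightarrow> 0"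
      by (rule Lim_null_comparison[OF _ LIMSEQ_inverse_real_of_nat])
         (use g(3)[OF i] in \<open>auto simp: less_imp_le simp del: of_nat_Suc\<close>)
  qed
qed

section \<open>The transform of integrable functions\<close>

text \<open>
  Collecting the terms of the exponent by the variables they contain separates the two chirps from the
  plane wave.
\<close>

lemma qpft_kernel_factorisation:
  fixes \<Lambda> :: "'n::finite \<Rightarrow> qpft_param"
  obtains \<phi> \<psi> :: "real^'n \<Rightarrow> complex" where
    "\<And>w x. qpft_kernel \<Lambda> w x = \<phi> w * (plane_wave (\<lambda>k. coeff_b (\<Lambda> k)) x w * \<psi> x)"
    "continuous_on UNIV \<phi>" "continuous_on UNIV \<psi>"
    "\<And>w. (norm (\<phi> w))\<^sup>2 = (\<Prod>k\<in>UNIV. \<bar>coeff_b (\<Lambda> k)\<bar> / (2 * pi))"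
    "\<And>x. norm (\<psi> x) = 1"
proof
  let ?a = "\<lambda>k. coeff_a (\<Lambda> k)" and ?b = "\<lambda>k. coeff_b (\<Lambda> k)" and ?c = "\<lambda>k. coeff_c (\<Lambda> k)"
    and ?d = "\<lambda>k. coeff_d (\<Lambda> k)" and ?e = "\<lambda>k. coeff_e (\<Lambda> k)"
  define C where "C = (\<Prod>k\<in>UNIV. csqrt (complex_of_real (?b k) / (2 * complex_of_real pi * \<i>)))"
  define \<phi> where "\<phi> w = C * exp (\<i> * of_real (\<Sum>k\<in>UNIV. ?c k * (w $ k)\<^sup>2 + ?e k * w $ k))" for w :: "real^'n"
  define \<psi> where "\<psi> x = exp (\<i> * of_real (\<Sum>k\<in>UNIV. ?a k * (x $ k)\<^sup>2 + ?d k * x $ k))" for x :: "real^'n"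
  show "qpft_kernel \<Lambda> w x = \<phi> w * (plane_wave ?b x w * \<psi> x)" for w x
  proof -
    have "qpft_kernel \<Lambda> w x = C * exp (\<i> * of_real (\<Sum>k\<in>UNIV. ?a k * (x $ k)\<^sup>2 + ?b k * x $ k * w $ k
        + ?c k * (w $ k)\<^sup>2 + ?d k * x $ k + ?e k * w $ k))"
      by (simp only: qpft_kernel_def prod.distrib C_def of_real_sum sum_distrib_left exp_sum[OF finite])
    also have "(\<Sum>k\<in>UNIV. ?a k * (x $ k)\<^sup>2 + ?b k * x $ k * w $ k
        + ?c k * (w $ k)\<^sup>2 + ?d k * x $ k + ?e k * w $ k) =
        (\<Sum>k\<in>UNIV. ?c k * (w $ k)\<^sup>2 + ?e k * w $ k) + ((\<Sum>k\<in>UNIV. ?b k * x $ k * w $ k) +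
        (\<Sum>k\<in>UNIV. ?a k * (x $ k)\<^sup>2 + ?d k * x $ k))"
      by (simp add: sum.distrib)
    finally show ?thesis
      by (simp only: \<phi>_def \<psi>_def plane_wave_def of_real_add distrib_left exp_add mult.assoc)
  qed
  show "continuous_on UNIV \<phi>" "continuous_on UNIV \<psi>"
    unfolding \<phi>_def \<psi>_def by (intro continuous_intros)+
  show "norm (\<psi> x) = 1" for x by (simp add: \<psi>_def del: of_real_sum)
  show "(norm (\<phi> w))\<^sup>2 = (\<Prod>k\<in>UNIV. \<bar>?b k\<bar> / (2 * pi))" for w
  proof -
    have "norm (\<phi> w) = norm C" by (simp add: \<phi>_def norm_mult del: of_real_sum)
    also have "norm C = (\<Prod>k\<in>UNIV. sqrt (\<bar>?b k\<bar> / (2 * pi)))"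
      by (simp add: C_def prod_norm[symmetric] norm_divide norm_mult)
    finally show ?thesis by (simp add: prod_power_distrib)
  qed
qed

text \<open>
  The chirp in \<open>x\<close> is absorbed into \<open>f\<close>, the factor in \<open>\<omega>\<close> has constant modulus, and this
  constant cancels the one in Plancherel's identity.
\<close>

lemma qpft_L1_Cc_isometry:
  fixes \<Lambda> :: "'n::finite \<Rightarrow> qpft_param"
  assumes b: "\<And>k. coeff_b (\<Lambda> k) \<noteq> 0" and f: "f \<in> Cc_space"
  shows "qpft_L1 \<Lambda> f \<in> L2_space" and "L2_norm (qpft_L1 \<Lambda> f) = L2_norm f"
proof -
  let ?b = "\<lambda>k. coeff_b (\<Lambda> k)"
  obtain \<phi> \<psi> :: "real^'n \<Rightarrow> complex" where K: "\<And>w x. qpft_kernel \<Lambda> w x = \<phi> w * (plane_wave ?b x w * \<psi> x)"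
    and c: "continuous_on UNIV \<phi>" "continuous_on UNIV \<psi>"
    and n: "\<And>w. (norm (\<phi> w))\<^sup>2 = (\<Prod>k\<in>UNIV. \<bar>?b k\<bar> / (2 * pi))" "\<And>x. norm (\<psi> x) = 1"
    by (rule qpft_kernel_factorisation[of \<Lambda>]) (rule that)
  define h where "h x = \<psi> x * f x" for x
  define F where "F w = (LINT x|lborel. plane_wave ?b x w * h x)" for w
  have h: "h \<in> Cc_space" unfolding h_def by (rule Cc_mult[OF c(2) f])
  note [measurable] = Cc_borel[OF h] Cc_borel[OF f]
  have [measurable]: "F \<in> borel_measurable borel"
    unfolding F_def by (rule plane_wave_transform_measurable) simp
  have [measurable]: "\<phi> \<in> borel_measurable borel"
    by (rule borel_measurable_continuous_onI[OF c(1)])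
  have Q: "qpft_L1 \<Lambda> f w = \<phi> w * F w" for w
  proof -
    have "continuous_on UNIV (\<lambda>x. plane_wave ?b x w)"
      unfolding plane_wave_def by (intro continuous_intros)
    then have [measurable]: "(\<lambda>x. plane_wave ?b x w) \<in> borel_measurable borel"
      by (rule borel_measurable_continuous_onI)
    have "qpft_L1 \<Lambda> f w = (LINT x|lebesgue. \<phi> w * (plane_wave ?b x w * h x))"
      unfolding qpft_L1_def K h_def by (simp only: mult.assoc)
    also have "\<dots> = (LINT x|lborel. \<phi> w * (plane_wave ?b x w * h x))"
      by (rule integral_completion) measurable
    finally show ?thesis by (simp add: F_def)
  qed
  have sq: "(norm (qpft_L1 \<Lambda> f w))\<^sup>2 = (\<Prod>k\<in>UNIV. \<bar>?b k\<bar> / (2 * pi)) * (norm (F w))\<^sup>2" for w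
    by (simp only: Q norm_mult power_mult_distrib n)
  have QF: "qpft_L1 \<Lambda> f = (\<lambda>w. \<phi> w * F w)" using Q by (rule ext)
  have m [measurable]: "qpft_L1 \<Lambda> f \<in> borel_measurable borel" unfolding QF by measurable
  note P = plancherel_Cc[where b="\<lambda>k. coeff_b (\<Lambda> k)", OF b h, folded F_def]
  have i: "integrable lborel (\<lambda>w. (norm (qpft_L1 \<Lambda> f w))\<^sup>2)"
    unfolding sq by (rule integrable_mult_right) (rule P(1))
  have "integrable lebesgue (\<lambda>w. (norm (qpft_L1 \<Lambda> f w))\<^sup>2)"
    by (subst integrable_completion) (use i in auto)
  moreover have "qpft_L1 \<Lambda> f \<in> borel_measurable lebesgue"
    by (rule measurable_completion) (use m in simp)
  ultimately show "qpft_L1 \<Lambda> f \<in> L2_space" by (simp add: L2_space_def)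
  have "(LINT w|lebesgue. (norm (qpft_L1 \<Lambda> f w))\<^sup>2) = (LINT w|lborel. (norm (qpft_L1 \<Lambda> f w))\<^sup>2)"
    by (rule integral_completion) measurable
  also have "\<dots> = (\<Prod>k\<in>UNIV. \<bar>?b k\<bar> / (2 * pi)) * ((\<Prod>k\<in>UNIV. 2 * pi / \<bar>?b k\<bar>) * (LINT x|lborel. (norm (h x))\<^sup>2))"
    unfolding sq integral_mult_right_zero P(2) ..
  also have "\<dots> = (LINT x|lborel. (norm (h x))\<^sup>2)"
    unfolding mult.assoc[symmetric] prod.distrib[symmetric] using b by simp
  also have "\<dots> = (LINT x|lborel. (norm (f x))\<^sup>2)"
    by (simp add: h_def norm_mult n)
  also have "\<dots> = (LINT x|lebesgue. (norm (f x))\<^sup>2)"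
    by (rule integral_completion[symmetric]) measurable
  finally show "L2_norm (qpft_L1 \<Lambda> f) = L2_norm f" by (simp add: L2_norm_def)
qed

text \<open>
  The modulus of the kernel does not depend on its arguments.
\<close>

lemma qpft_L1_integrand:
  fixes \<Lambda> :: "'n::finite \<Rightarrow> qpft_param"
  obtains B where "\<And>w x. norm (qpft_kernel \<Lambda> w x) = B"
    "\<And>f w. integrable lebesgue f \<Longrightarrow> integrable lebesgue (\<lambda>x. qpft_kernel \<Lambda> w x * f x)"
proof -
  let ?b = "\<lambda>k. coeff_b (\<Lambda> k)"
  obtain \<phi> \<psi> :: "real^'n \<Rightarrow> complex" where K: "\<And>w x. qpft_kernel \<Lambda> w x = \<phi> w * (plane_wave ?b x w * \<psi> x)"
    and c: "continuous_on UNIV \<phi>" "continuous_on UNIV \<psi>"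
    and n: "\<And>w. (norm (\<phi> w))\<^sup>2 = (\<Prod>k\<in>UNIV. \<bar>?b k\<bar> / (2 * pi))" "\<And>x. norm (\<psi> x) = 1"
    by (rule qpft_kernel_factorisation[of \<Lambda>]) (rule that)
  define B where "B = sqrt (\<Prod>k\<in>UNIV. \<bar>?b k\<bar> / (2 * pi))"
  have B: "norm (qpft_kernel \<Lambda> w x) = B" for w x
  proof -
    have "norm (qpft_kernel \<Lambda> w x) = norm (\<phi> w)" by (simp add: K norm_mult n)
    also have "\<dots> = sqrt ((norm (\<phi> w))\<^sup>2)" by simp
    finally show ?thesis by (simp only: n B_def)
  qed
  moreover have "integrable lebesgue (\<lambda>x. qpft_kernel \<Lambda> w x * f x)" if f: "integrable lebesgue f" for f w
  proof (rule Bochner_Integration.integrable_bound)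
    have "continuous_on UNIV (qpft_kernel \<Lambda> w)"
      unfolding K[abs_def] plane_wave_def by (intro continuous_intros c)
    then have "qpft_kernel \<Lambda> w \<in> borel_measurable lebesgue"
      by (intro measurable_completion) (simp add: borel_measurable_continuous_onI)
    then show "(\<lambda>x. qpft_kernel \<Lambda> w x * f x) \<in> borel_measurable lebesgue"
      by (rule borel_measurable_times) (rule borel_measurable_integrable[OF f])
    show "integrable lebesgue (\<lambda>x. of_real B * f x)" by (rule integrable_mult_right) (rule f)
    have "B \<ge> 0" unfolding B_def by (intro real_sqrt_ge_zero prod_nonneg) simp
    then show "AE x in lebesgue. norm (qpft_kernel \<Lambda> w x * f x) \<le> norm (of_real B * f x)"
      by (simp add: norm_mult B)
  qed
  ultimately show thesis by (rule that)
qed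

lemma qpft_L1_linear:
  fixes \<Lambda> :: "'n::finite \<Rightarrow> qpft_param"
  assumes f: "integrable lebesgue f" and g: "integrable lebesgue g"
  shows "qpft_L1 \<Lambda> (\<lambda>x. f x + c * g x) w = qpft_L1 \<Lambda> f w + c * qpft_L1 \<Lambda> g w"
proof -
  obtain B where "\<And>w x. norm (qpft_kernel \<Lambda> w x) = B"
    and I: "\<And>f w. integrable lebesgue f \<Longrightarrow> integrable lebesgue (\<lambda>x. qpft_kernel \<Lambda> w x * f x)"
    by (rule qpft_L1_integrand[of \<Lambda>]) (rule that)
  have "qpft_L1 \<Lambda> (\<lambda>x. f x + c * g x) w =
      (LINT x|lebesgue. qpft_kernel \<Lambda> w x * f x + c * (qpft_kernel \<Lambda> w x * g x))"
    unfolding qpft_L1_def by (simp only: distrib_left mult.left_commute)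
  also have "\<dots> = (LINT x|lebesgue. qpft_kernel \<Lambda> w x * f x) + (LINT x|lebesgue. c * (qpft_kernel \<Lambda> w x * g x))"
    by (intro Bochner_Integration.integral_add integrable_mult_right I f g)
  finally show ?thesis by (simp only: qpft_L1_def integral_mult_right_zero)
qed

text \<open>
  Since the kernel is bounded, \<open>L\<^sup>1\<close>-convergence implies uniform convergence of the transforms.
\<close>

lemma qpft_L1_tendsto:
  fixes \<Lambda> :: "'n::finite \<Rightarrow> qpft_param"
  assumes u: "\<And>n. integrable lebesgue (u n)" and f: "integrable lebesgue f"
    and lim: "(\<lambda>n. LINT x|lebesgue. norm (u n x - f x)) \<longlonglongrightarrow> 0"
  shows "(\<lambda>n. qpft_L1 \<Lambda> (u n) w) \<longlonglongrightarrow> qpft_L1 \<Lambda> f w"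
proof -
  obtain B where B: "\<And>w x. norm (qpft_kernel \<Lambda> w x) = B"
    and I: "\<And>f w. integrable lebesgue f \<Longrightarrow> integrable lebesgue (\<lambda>x. qpft_kernel \<Lambda> w x * f x)"
    by (rule qpft_L1_integrand[of \<Lambda>]) (rule that)
  have le: "norm (qpft_L1 \<Lambda> (u n) w - qpft_L1 \<Lambda> f w) \<le> B * (LINT x|lebesgue. norm (u n x - f x))" for n
  proof -
    have "qpft_L1 \<Lambda> (u n) w - qpft_L1 \<Lambda> f w =
        (LINT x|lebesgue. qpft_kernel \<Lambda> w x * u n x - qpft_kernel \<Lambda> w x * f x)"
      unfolding qpft_L1_def by (intro Bochner_Integration.integral_diff[symmetric] I u f)
    also have "norm \<dots> \<le> (LINT x|lebesgue. norm (qpft_kernel \<Lambda> w x * u n x - qpft_kernel \<Lambda> w x * f x))"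
      by (rule integral_norm_bound)
    also have "\<dots> = (LINT x|lebesgue. B * norm (u n x - f x))"
      by (simp only: norm_mult B right_diff_distrib[symmetric])
    finally show ?thesis by (simp only: integral_mult_right_zero)
  qed
  have "(\<lambda>n. B * (LINT x|lebesgue. norm (u n x - f x))) \<longlonglongrightarrow> B * 0"
    by (intro tendsto_intros lim)
  then have "(\<lambda>n. B * (LINT x|lebesgue. norm (u n x - f x))) \<longlonglongrightarrow> 0" by simp
  then show ?thesis
    by (rule LIM_zero_cancel[OF Lim_null_comparison[OF always_eventually[OF allI[OF le]]]])
qed

section \<open>The extension to square-integrable functions\<close>

text \<open>
  The graph of the extension, up to almost everywhere equality. A relation avoids choosing
  representatives before existence is known, and it can be compared with every continuous extension.
\<close>

definition qpft_limit ::
    "('n::finite \<Rightarrow> qpft_param) \<Rightarrow> (real^'n \<Rightarrow> complex) \<Rightarrow> (real^'n \<Rightarrow> complex) \<Rightarrow> bool" where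
  "qpft_limit \<Lambda> f h \<longleftrightarrow> f \<in> L2_space \<and> h \<in> L2_space \<and> (\<exists>u. (\<forall>n. u n \<in> Cc_space) \<and>
     (\<lambda>n. L2_norm (\<lambda>x. u n x - f x)) \<longlonglongrightarrow> 0 \<and>
     (\<lambda>n. L2_norm (\<lambda>w. qpft_L1 \<Lambda> (u n) w - h w)) \<longlonglongrightarrow> 0)"

lemma L2_tendsto_linear:
  assumes u: "\<And>n. u n \<in> L2_space" and f: "f \<in> L2_space" and v: "\<And>n. v n \<in> L2_space" and g: "g \<in> L2_space"
    and l: "(\<lambda>n. L2_norm (\<lambda>x. u n x - f x)) \<longlonglongrightarrow> 0" "(\<lambda>n. L2_norm (\<lambda>x. v n x - g x)) \<longlonglongrightarrow> 0"
  shows "(\<lambda>n. L2_norm (\<lambda>x. (u n x + c * v n x) - (f x + c * g x))) \<longlonglongrightarrow> 0"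
proof (rule Lim_null_comparison)
  show "\<forall>\<^sub>F n in sequentially. norm (L2_norm (\<lambda>x. (u n x + c * v n x) - (f x + c * g x)))
      \<le> L2_norm (\<lambda>x. u n x - f x) + norm c * L2_norm (\<lambda>x. v n x - g x)"
  proof (intro always_eventually allI)
    fix n
    have "L2_norm (\<lambda>x. (u n x - f x) + c * (v n x - g x)) \<le>
        L2_norm (\<lambda>x. u n x - f x) + L2_norm (\<lambda>x. c * (v n x - g x))"
      by (intro L2_triangle L2_diff L2_cmult u f v g)
    moreover have "(\<lambda>x. (u n x - f x) + c * (v n x - g x)) = (\<lambda>x. (u n x + c * v n x) - (f x + c * g x))"
      by (simp add: algebra_simps fun_eq_iff)
    ultimately show "norm (L2_norm (\<lambda>x. (u n x + c * v n x) - (f x + c * g x)))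
      \<le> L2_norm (\<lambda>x. u n x - f x) + norm c * L2_norm (\<lambda>x. v n x - g x)"
      by (simp add: L2_norm_nonneg L2_norm_cmult)
  qed
  have "(\<lambda>n. L2_norm (\<lambda>x. u n x - f x) + norm c * L2_norm (\<lambda>x. v n x - g x)) \<longlonglongrightarrow> 0 + norm c * 0"
    by (intro tendsto_intros l)
  then show "(\<lambda>n. L2_norm (\<lambda>x. u n x - f x) + norm c * L2_norm (\<lambda>x. v n x - g x)) \<longlonglongrightarrow> 0" by simp
qed

context
  fixes \<Lambda> :: "'n::finite \<Rightarrow> qpft_param"
  assumes b: "\<And>k. coeff_b (\<Lambda> k) \<noteq> 0"
begin

lemma qpft_limit_isometry:
  assumes "qpft_limit \<Lambda> f h"
  shows "L2_norm h = L2_norm f"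
proof -
  obtain u where u: "\<And>n. u n \<in> Cc_space" and f: "f \<in> L2_space" and h: "h \<in> L2_space"
    and l: "(\<lambda>n. L2_norm (\<lambda>x. u n x - f x)) \<longlonglongrightarrow> 0"
      "(\<lambda>n. L2_norm (\<lambda>w. qpft_L1 \<Lambda> (u n) w - h w)) \<longlonglongrightarrow> 0"
    using assms by (auto simp: qpft_limit_def)
  have "(\<lambda>n. L2_norm (qpft_L1 \<Lambda> (u n))) \<longlonglongrightarrow> L2_norm h"
    by (intro L2_norm_tendsto qpft_L1_Cc_isometry b u h l)
  moreover have "(\<lambda>n. L2_norm (qpft_L1 \<Lambda> (u n))) \<longlonglongrightarrow> L2_norm f"
    unfolding qpft_L1_Cc_isometry(2)[OF b u] by (intro L2_norm_tendsto Cc_L2 u f l)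
  ultimately show ?thesis by (rule LIMSEQ_unique)
qed

lemma qpft_limit_linear:
  assumes "qpft_limit \<Lambda> f h" "qpft_limit \<Lambda> g k"
  shows "qpft_limit \<Lambda> (\<lambda>x. f x + c * g x) (\<lambda>w. h w + c * k w)"
proof -
  obtain u where u: "\<And>n. u n \<in> Cc_space" and f: "f \<in> L2_space" and h: "h \<in> L2_space"
    and lu: "(\<lambda>n. L2_norm (\<lambda>x. u n x - f x)) \<longlonglongrightarrow> 0"
      "(\<lambda>n. L2_norm (\<lambda>w. qpft_L1 \<Lambda> (u n) w - h w)) \<longlonglongrightarrow> 0"
    using assms(1) by (auto simp: qpft_limit_def)
  obtain v where v: "\<And>n. v n \<in> Cc_space" and g: "g \<in> L2_space" and k: "k \<in> L2_space"
    and lv: "(\<lambda>n. L2_norm (\<lambda>x. v n x - g x)) \<longlonglongrightarrow> 0"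
      "(\<lambda>n. L2_norm (\<lambda>w. qpft_L1 \<Lambda> (v n) w - k w)) \<longlonglongrightarrow> 0"
    using assms(2) by (auto simp: qpft_limit_def)
  have 1: "(\<lambda>x. u n x + c * v n x) \<in> Cc_space" for n
    by (intro Cc_add u Cc_mult v continuous_intros)
  have 2: "(\<lambda>n. L2_norm (\<lambda>x. (u n x + c * v n x) - (f x + c * g x))) \<longlonglongrightarrow> 0"
    by (intro L2_tendsto_linear Cc_L2 u v f g lu lv)
  have "(\<lambda>n. L2_norm (\<lambda>w. (qpft_L1 \<Lambda> (u n) w + c * qpft_L1 \<Lambda> (v n) w) - (h w + c * k w))) \<longlonglongrightarrow> 0"
    by (intro L2_tendsto_linear qpft_L1_Cc_isometry b u v h k lu lv)
  then have 3: "(\<lambda>n. L2_norm (\<lambda>w. qpft_L1 \<Lambda> (\<lambda>x. u n x + c * v n x) w - (h w + c * k w))) \<longlonglongrightarrow> 0"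
    unfolding qpft_L1_linear[OF Cc_integrable_lebesgue[OF u] Cc_integrable_lebesgue[OF v]] .
  show ?thesis
    unfolding qpft_limit_def
    by (intro conjI exI[of _ "\<lambda>n x. u n x + c * v n x"] allI L2_add L2_cmult f g h k 1 2 3)
qed

lemma qpft_limit_dist:
  assumes "qpft_limit \<Lambda> f h" "qpft_limit \<Lambda> g k"
  shows "L2_norm (\<lambda>w. h w - k w) = L2_norm (\<lambda>x. f x - g x)"
  using qpft_limit_isometry[OF qpft_limit_linear[OF assms, of "-1"]] by simp

lemma qpft_limit_Cc:
  assumes u: "u \<in> Cc_space"
  shows "qpft_limit \<Lambda> u (qpft_L1 \<Lambda> u)"
proof -
  have z: "L2_norm (\<lambda>x::real^'n. 0) = 0" by (simp add: L2_norm_def)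
  show ?thesis
    unfolding qpft_limit_def using Cc_L2[OF u] qpft_L1_Cc_isometry(1)[OF b u] u z
    by (intro conjI exI[of _ "\<lambda>_. u"]) auto
qed

text \<open>
  By the isometry, the transforms of an approximating sequence form a Cauchy sequence.
\<close>

lemma qpft_limit_exists:
  assumes f: "f \<in> L2_space"
  shows "\<exists>h. qpft_limit \<Lambda> f h"
proof -
  obtain u where u: "\<And>n. u n \<in> Cc_space" and l: "(\<lambda>n. L2_norm (\<lambda>x. u n x - f x)) \<longlonglongrightarrow> 0"
    using Cc_dense[OF f] by blast
  obtain h where h: "h \<in> L2_space" "(\<lambda>n. L2_norm (\<lambda>w. qpft_L1 \<Lambda> (u n) w - h w)) \<longlonglongrightarrow> 0"
  proof (rule L2_complete[of "\<lambda>n. qpft_L1 \<Lambda> (u n)"])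
    show "qpft_L1 \<Lambda> (u n) \<in> L2_space" for n by (rule qpft_L1_Cc_isometry(1)[OF b u])
    fix e :: real assume "e > 0"
    then have "\<forall>\<^sub>F n in sequentially. L2_norm (\<lambda>x. u n x - f x) < e / 2"
      by (intro order_tendstoD(2)[OF l]) simp
    then obtain N where N: "\<And>n. n \<ge> N \<Longrightarrow> L2_norm (\<lambda>x. u n x - f x) < e / 2"
      by (auto simp: eventually_sequentially)
    have "L2_norm (\<lambda>w. qpft_L1 \<Lambda> (u m) w - qpft_L1 \<Lambda> (u n) w) < e" if "m \<ge> N" "n \<ge> N" for m n
      using L2_triangle_sub[OF Cc_L2[OF u] f Cc_L2[OF u], of m n] N[OF that(1)] N[OF that(2)]
        L2_norm_minus_commute[of f "u n"] qpft_limit_dist[OF qpft_limit_Cc[OF u] qpft_limit_Cc[OF u], of m n] by simp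
    then show "\<exists>N. \<forall>m\<ge>N. \<forall>n\<ge>N. L2_norm (\<lambda>w. qpft_L1 \<Lambda> (u m) w - qpft_L1 \<Lambda> (u n) w) < e" by blast
  qed
  then show ?thesis unfolding qpft_limit_def using f u l by blast
qed

text \<open>
  For a sequence that approximates \<open>f\<close> in both norms, the transforms converge to \<open>h\<close> in
  \<open>L\<^sup>2\<close> and to the integral transform of \<open>f\<close> pointwise.
\<close>

lemma qpft_limit_L1:
  assumes q: "qpft_limit \<Lambda> f h" and f: "integrable lebesgue f"
  shows "AE w in lebesgue. h w = qpft_L1 \<Lambda> f w"
proof -
  have f2: "f \<in> L2_space" "h \<in> L2_space" using q by (auto simp: qpft_limit_def)
  obtain u where u: "\<And>n. u n \<in> Cc_space" and l2: "(\<lambda>n. L2_norm (\<lambda>x. u n x - f x)) \<longlonglongrightarrow> 0"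
    and l1: "(\<lambda>n. LINT x|lebesgue. norm (u n x - f x)) \<longlonglongrightarrow> 0"
    using Cc_dense[OF f2(1)] f by blast
  show ?thesis
  proof (rule L2_limit_eq_pointwise_limit[OF qpft_L1_Cc_isometry(1)[OF b u] f2(2)])
    show "(\<lambda>n. L2_norm (\<lambda>w. qpft_L1 \<Lambda> (u n) w - h w)) \<longlonglongrightarrow> 0"
      unfolding qpft_limit_dist[OF qpft_limit_Cc[OF u] q] by (rule l2)
    show "AE w in lebesgue. (\<lambda>n. qpft_L1 \<Lambda> (u n) w) \<longlonglongrightarrow> qpft_L1 \<Lambda> f w"
      by (intro AE_I2 qpft_L1_tendsto Cc_integrable_lebesgue u f l1)
  qed
qed

lemma qpft_extension_exists: "\<exists>T. is_continuous_qpft_extension \<Lambda> T"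
proof -
  obtain T where T: "\<And>f. f \<in> L2_space \<Longrightarrow> qpft_limit \<Lambda> f (T f)"
    using qpft_limit_exists by metis
  have "is_continuous_qpft_extension \<Lambda> T"
    unfolding is_continuous_qpft_extension_def
  proof (intro conjI ballI allI impI)
    fix f :: "real^'n \<Rightarrow> complex" assume "f \<in> L2_space"
    then show "T f \<in> L2_space" using T by (simp add: qpft_limit_def)
  next
    fix f :: "real^'n \<Rightarrow> complex" assume "f \<in> L1_space \<inter> L2_space"
    then show "AE w in lebesgue. T f w = qpft_L1 \<Lambda> f w"
      by (intro qpft_limit_L1 T) (auto simp: L1_space_def)
  next
    fix f :: "real^'n \<Rightarrow> complex" and e :: real assume f: "f \<in> L2_space" and e: "e > 0"
    show "\<exists>d>0. \<forall>g\<in>L2_space. L2_norm (\<lambda>x. g x - f x) < d \<longrightarrow> L2_norm (\<lambda>w. T g w - T f w) < e"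
      using e qpft_limit_dist[OF T T[OF f]] by (intro exI[of _ e]) auto
  qed
  then show ?thesis by (rule exI[where x=T])
qed

text \<open>
  A continuous extension agrees with the integral transform on the dense subspace, and its continuity at
  \<open>f\<close> turns an approximation of \<open>f\<close> into one of \<open>T f\<close>.
\<close>

lemma qpft_extension_limit:
  assumes T: "is_continuous_qpft_extension \<Lambda> T" and f: "f \<in> L2_space"
  shows "qpft_limit \<Lambda> f (T f)"
proof -
  have T1: "\<And>f. f \<in> L2_space \<Longrightarrow> T f \<in> L2_space"
    and T2: "\<And>f. f \<in> L1_space \<inter> L2_space \<Longrightarrow> AE \<omega> in lebesgue. T f \<omega> = qpft_L1 \<Lambda> f \<omega>"
    and T3: "\<And>f e. f \<in> L2_space \<Longrightarrow> e > 0 \<Longrightarrow> \<exists>d>0. \<forall>g\<in>L2_space.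
        L2_norm (\<lambda>x. g x - f x) < d \<longrightarrow> L2_norm (\<lambda>\<omega>. T g \<omega> - T f \<omega>) < e"
    using T unfolding is_continuous_qpft_extension_def by blast+
  obtain u where u: "\<And>n. u n \<in> Cc_space" and l: "(\<lambda>n. L2_norm (\<lambda>x. u n x - f x)) \<longlonglongrightarrow> 0"
    using Cc_dense[OF f] by blast
  have eq: "L2_norm (\<lambda>w. qpft_L1 \<Lambda> (u n) w - T f w) = L2_norm (\<lambda>w. T (u n) w - T f w)" for n
  proof (rule L2_norm_cong_AE)
    have "u n \<in> L1_space \<inter> L2_space"
      using Cc_L2[OF u] Cc_integrable_lebesgue[OF u] by (simp add: L1_space_def)
    from T2[OF this] show "AE w in lebesgue. qpft_L1 \<Lambda> (u n) w - T f w = T (u n) w - T f w"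
      by eventually_elim simp
  qed (intro L2_measurable L2_diff qpft_L1_Cc_isometry b u T1 f Cc_L2)+
  have "(\<lambda>n. L2_norm (\<lambda>w. qpft_L1 \<Lambda> (u n) w - T f w)) \<longlonglongrightarrow> 0"
    unfolding eq
  proof (rule LIMSEQ_I)
    fix e :: real assume "e > 0"
    then obtain d where d: "d > 0"
      "\<And>g. g \<in> L2_space \<Longrightarrow> L2_norm (\<lambda>x. g x - f x) < d \<Longrightarrow> L2_norm (\<lambda>w. T g w - T f w) < e"
      using T3[OF f] by blast
    obtain N where "\<And>n. n \<ge> N \<Longrightarrow> L2_norm (\<lambda>x. u n x - f x) < d"
      using order_tendstoD(2)[OF l d(1)] by (auto simp: eventually_sequentially)
    then have "\<forall>n\<ge>N. norm (L2_norm (\<lambda>w. T (u n) w - T f w) - 0) < e"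
      using d(2)[OF Cc_L2[OF u]] by (simp add: L2_norm_nonneg)
    then show "\<exists>N. \<forall>n\<ge>N. norm (L2_norm (\<lambda>w. T (u n) w - T f w) - 0) < e" by blast
  qed
  then show ?thesis unfolding qpft_limit_def using f T1[OF f] u l by blast
qed

end

theorem theorem2p4:
  fixes \<Lambda> :: "'n::finite \<Rightarrow> qpft_param"
    and f g :: "real ^ 'n \<Rightarrow> complex"
  assumes "\<And>k. coeff_b (\<Lambda> k) \<noteq> 0"
    and "f \<in> L2_space"
    and "g \<in> L2_space"
  shows "L2_inner f g = L2_inner (qpft_L2 \<Lambda> f) (qpft_L2 \<Lambda> g)"
proof -
  have "is_continuous_qpft_extension \<Lambda> (qpft_L2 \<Lambda>)"
    unfolding qpft_L2_def by (rule someI_ex[OF qpft_extension_exists[OF assms(1)]])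
  then have q: "qpft_limit \<Lambda> f (qpft_L2 \<Lambda> f)" "qpft_limit \<Lambda> g (qpft_L2 \<Lambda> g)"
    by (auto intro: qpft_extension_limit[OF assms(1)] assms(2,3))
  then have "qpft_L2 \<Lambda> f \<in> L2_space" "qpft_L2 \<Lambda> g \<in> L2_space"
    by (auto simp: qpft_limit_def)
  then show ?thesis
    by (simp only: L2_inner_polarisation assms(2,3) qpft_limit_isometry[OF assms(1) qpft_limit_linear[OF assms(1) q]])
qed

end
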